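(* Let $(E,T,S,e)$ be a conditional expectation preserving system. Then the following are equivalent: (1) $(E,T,S,e)$ is weakly mixing, i.e. for all band projections $P,Q$ on $E$, $\frac{1}{n}\sum_{k=0}^{n-1}\left|T\big((S^kPe)\cdot Qe\big)-TPe\cdot TQe\right|\to 0$ in order as $n\to\infty$; (2) for all $f,g\in E_e$, $\frac{1}{n}\sum_{k=0}^{n-1}\left|T\big((S^kf)\cdot g\big)-Tf\cdot Tg\right|\to 0$ in order as $n\to\infty$; (3) for each pair of band projections $P,Q$ on $E$ there is a density zero sequence of band projections $(R_n)_{n\in\mathbb{N}_0}$ on $E$ such that $(I-R_n)\left|T\big((S^nPe)\cdot Qe\big)-TPe\cdot TQe\right|\to 0$ in order as $n\to\infty$.
   Context: Let $E$ be a Dedekind complete Riesz space with weak order unit $e$. A conditional expectation operator on $E$ is a positive order continuous projection $T:E\to E$ whose range is a Dedekind complete Riesz subspace of $E$ and such that $Tu$ is a weak order unit of $E$ for every weak order unit $u$ of $E$. $(E,T,S,e)$ is called a conditional expectation preserving system if $T$ is a conditional expectation operator on $E$ with $Te=e$, and $S$ is an order continuous Riesz homomorphism on $E$ with $Se=e$ and $TSPe=TPe$ for every band projection $P$ on $E$. $E_e=\{f\in E: |f|\le ke \text{ for some } k\in\mathbb{R}_+\}$ is the ideal of $e$-bounded elements; it is an $f$-algebra with unit $e$, whose multiplication $\cdot$ is determined by $Pe\cdot Qe=PQe$ for band projections $P,Q$, extended linearly and by order limits to $E_e$. (The paper writes $T((S^kP)Qe)$ for $T((S^kPe)\cdot Qe)$.)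 A sequence $(R_n)_{n\in\mathbb{N}_0}$ of band projections is of density zero if $\frac{1}{n}\sum_{k=0}^{n-1}R_k\to 0$ in order as $n\to\infty$. $I$ is the identity operator. *)

theory Defs
  imports Complex_Main
begin

text \<open>A Dedekind complete Riesz space is modelled as a type of class
  ordered_real_vector and conditionally_complete_lattice (every nonempty
  set bounded above has a supremum).\<close>

definition rabs :: "'a::{ordered_real_vector, lattice} \<Rightarrow> 'a" where
  "rabs x = sup x (- x)"

definition rs_ideal :: "'a::{ordered_real_vector, lattice} set \<Rightarrow> bool" where
  "rs_ideal B \<longleftrightarrow> 0 \<in> B \<and> (\<forall>x\<in>B. \<forall>y\<in>B. x + y \<in> B) \<and> (\<forall>x\<in>B. \<forall>c. c *\<^sub>R x \<in> B)
     \<and> (\<forall>x\<in>B. \<forall>y. rabs y \<le> rabs x \<longrightarrow> y \<in> B)"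

definition rs_band :: "'a::{ordered_real_vector, conditionally_complete_lattice} set \<Rightarrow> bool" where
  "rs_band B \<longleftrightarrow> rs_ideal B \<and> (\<forall>A. A \<subseteq> B \<and> A \<noteq> {} \<and> bdd_above A \<longrightarrow> Sup A \<in> B)"

definition disj_compl :: "'a::{ordered_real_vector, lattice} set \<Rightarrow> 'a set" where
  "disj_compl B = {x. \<forall>y\<in>B. inf (rabs x) (rabs y) = 0}"

definition band_projection :: "('a::{ordered_real_vector, conditionally_complete_lattice} \<Rightarrow> 'a) \<Rightarrow> bool" where
  "band_projection P \<longleftrightarrow> (\<exists>B. rs_band B \<and> (\<forall>x. P x \<in> B \<and> x - P x \<in> disj_compl B))"

definition weak_order_unit :: "'a::{ordered_real_vector, conditionally_complete_lattice} \<Rightarrow> bool" where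
  "weak_order_unit u \<longleftrightarrow> 0 \<le> u \<and> \<Inter>{B. rs_band B \<and> u \<in> B} = UNIV"

definition positive_op :: "('a::{ordered_real_vector, lattice} \<Rightarrow> 'b::{ordered_real_vector, lattice}) \<Rightarrow> bool" where
  "positive_op T \<longleftrightarrow> (\<forall>x. 0 \<le> x \<longrightarrow> 0 \<le> T x)"

definition order_continuous :: "('a::{ordered_real_vector, conditionally_complete_lattice} \<Rightarrow> 'a) \<Rightarrow> bool" where
  "order_continuous T \<longleftrightarrow> (\<forall>D. D \<noteq> {} \<and> (\<forall>x\<in>D. 0 \<le> x)
      \<and> (\<forall>x\<in>D. \<forall>y\<in>D. \<exists>z\<in>D. z \<le> x \<and> z \<le> y) \<and> Inf D = 0 \<longrightarrow> Inf (T ` D) = 0)"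

definition dc_riesz_subspace :: "'a::{ordered_real_vector, conditionally_complete_lattice} set \<Rightarrow> bool" where
  "dc_riesz_subspace R \<longleftrightarrow> 0 \<in> R \<and> (\<forall>x\<in>R. \<forall>y\<in>R. x + y \<in> R) \<and> (\<forall>x\<in>R. \<forall>c. c *\<^sub>R x \<in> R)
     \<and> (\<forall>x\<in>R. \<forall>y\<in>R. sup x y \<in> R)
     \<and> (\<forall>A. A \<subseteq> R \<and> A \<noteq> {} \<and> (\<exists>u\<in>R. \<forall>a\<in>A. a \<le> u) \<longrightarrow>
          (\<exists>s\<in>R. (\<forall>a\<in>A. a \<le> s) \<and> (\<forall>u\<in>R. (\<forall>a\<in>A. a \<le> u) \<longrightarrow> s \<le> u)))"

definition cond_exp_op :: "('a::{ordered_real_vector, conditionally_complete_lattice} \<Rightarrow> 'a) \<Rightarrow> bool" where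
  "cond_exp_op T \<longleftrightarrow> linear T \<and> positive_op T \<and> order_continuous T \<and> T \<circ> T = T
     \<and> dc_riesz_subspace (range T) \<and> (\<forall>u. weak_order_unit u \<longrightarrow> weak_order_unit (T u))"

definition riesz_hom :: "('a::{ordered_real_vector, lattice} \<Rightarrow> 'a) \<Rightarrow> bool" where
  "riesz_hom S \<longleftrightarrow> linear S \<and> (\<forall>x y. S (sup x y) = sup (S x) (S y))"

definition CEPS :: "('a::{ordered_real_vector, conditionally_complete_lattice} \<Rightarrow> 'a) \<Rightarrow> ('a \<Rightarrow> 'a) \<Rightarrow> 'a \<Rightarrow> bool" where
  "CEPS T S e \<longleftrightarrow> weak_order_unit e \<and> cond_exp_op T \<and> T e = e
     \<and> riesz_hom S \<and> order_continuous S \<and> S e = e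
     \<and> (\<forall>P. band_projection P \<longrightarrow> T (S (P e)) = T (P e))"

definition Ee :: "'a::{ordered_real_vector, lattice} \<Rightarrow> 'a set" where
  "Ee e = {f. \<exists>k::real. 0 \<le> k \<and> rabs f \<le> k *\<^sub>R e}"

text \<open>f-algebra multiplication on A with unit e (extended by 0 outside A x A so that it
  is unique as a function), also satisfying Pe.Qe = PQe for band projections.\<close>
definition falg_mult :: "'a::{ordered_real_vector, conditionally_complete_lattice} set \<Rightarrow> 'a \<Rightarrow> ('a \<Rightarrow> 'a \<Rightarrow> 'a) \<Rightarrow> bool" where
  "falg_mult A e m \<longleftrightarrow>
     (\<forall>f\<in>A. \<forall>g\<in>A. m f g \<in> A)
   \<and> (\<forall>f g. f \<notin> A \<or> g \<notin> A \<longrightarrow> m f g = 0)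
   \<and> (\<forall>f\<in>A. \<forall>g\<in>A. \<forall>h\<in>A. \<forall>a b. m (a *\<^sub>R f + b *\<^sub>R g) h = a *\<^sub>R m f h + b *\<^sub>R m g h
                                   \<and> m h (a *\<^sub>R f + b *\<^sub>R g) = a *\<^sub>R m h f + b *\<^sub>R m h g)
   \<and> (\<forall>f\<in>A. \<forall>g\<in>A. \<forall>h\<in>A. m (m f g) h = m f (m g h))
   \<and> (\<forall>f\<in>A. \<forall>g\<in>A. 0 \<le> f \<and> 0 \<le> g \<longrightarrow> 0 \<le> m f g)
   \<and> (\<forall>f\<in>A. \<forall>g\<in>A. \<forall>h\<in>A. inf f g = 0 \<and> 0 \<le> f \<and> 0 \<le> g \<and> 0 \<le> h \<longrightarrow>
          inf (m h f) g = 0 \<and> inf (m f h) g = 0)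
   \<and> (\<forall>f\<in>A. m e f = f \<and> m f e = f)
   \<and> (\<forall>P Q. band_projection P \<and> band_projection Q \<longrightarrow> m (P e) (Q e) = P (Q e))"

definition emult :: "'a::{ordered_real_vector, conditionally_complete_lattice} \<Rightarrow> 'a \<Rightarrow> 'a \<Rightarrow> 'a" where
  "emult e = (THE m. falg_mult (Ee e) e m)"

definition order_conv :: "(nat \<Rightarrow> 'a::{ordered_real_vector, conditionally_complete_lattice}) \<Rightarrow> 'a \<Rightarrow> bool" where
  "order_conv x l \<longleftrightarrow> (\<exists>p. decseq p \<and> (INF n. p n) = 0 \<and> (\<forall>n. rabs (x n - l) \<le> p n))"

text \<open>Density zero: (1/n) sum_{k<n} R_k converges in order to 0 in the (Dedekind complete)
  space of order bounded operators; since these averages are positive, this means there is a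
  sequence of linear operators D_n, decreasing in the operator order, dominating the averages,
  with infimum 0 (computed pointwise on the positive cone, Riesz-Kantorovich).\<close>
definition density_zero :: "(nat \<Rightarrow> 'a::{ordered_real_vector, conditionally_complete_lattice} \<Rightarrow> 'a) \<Rightarrow> bool" where
  "density_zero R \<longleftrightarrow> (\<exists>D. (\<forall>n. linear (D n))
      \<and> (\<forall>n x. 0 \<le> x \<longrightarrow> D (Suc n) x \<le> D n x)
      \<and> (\<forall>n x. 0 \<le> x \<longrightarrow> (1 / real n) *\<^sub>R (\<Sum>k<n. R k x) \<le> D n x)
      \<and> (\<forall>x. 0 \<le> x \<longrightarrow> (INF n. D n x) = 0))"

end

(*
  The real-valued Riesz homomorphisms phi of E_e with phi(e) = 1 ("characters") come from maximal
  ideals and separate the points of E_e, so that (in)equalities in E_e are checked on real numbers.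
  The product on E_e is the unique operation that all characters turn into multiplication.

  (1) => (2): T((S^k f) g) - Tf Tg is bilinear and uniformly bounded in f and g, and halving shows
  that each 0 <= f <= c e is a uniform limit of combinations of components Pe.

  (1) <=> (3): let a_n be the absolute value in question, with Cesaro means dominated by q_n, where
  q_n decreases to 0. Put b_n = sqrt(q_n) and let R_n be the projection onto the band of (a_n - b_n)^+.
  Then (I - R_n) a_n <= b_n. Since b is decreasing, b_n times the n-th mean of the R_k e is at most
  q_n = b_n^2, so that mean is at most b_n. The dominating operators D_n are the multiplications by
  inf b_n e, extended from E_e to E. Conversely, R_k a_k is at most a multiple of R_k e.
*)
theory Submission
  imports Defs "HOL-Library.Lattice_Algebras"
begin

section \<open>Riesz spaces and ideals\<close>

text \<open>\<open>emult\<close> is a definite description over a list of axioms, so nothing is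
  known about it until a product with these axioms has been constructed and shown to be unique;
  characters serve both purposes. Their weakness is that they preserve only finite lattice
  operations. Where an element arises as a supremum or infimum (squares, square roots), its value
  under a given character therefore comes from an explicit majorant or minorant adapted to that
  character.

  The square root balances two demands on the threshold in the density argument: it has to tend to
  0, and so does q_n divided by it.

  \<open>density_zero\<close> speaks of operators on the whole space, while characters control only
  \<open>Ee e\<close>. The gap is closed by truncation: since \<open>e\<close> is a weak order unit,
  the elements \<open>x - inf x (j e)\<close> have no nonzero positive common minorant, and neither
  averages of band projections nor multiplications by an element of [0, e] enlarge a positive
  element, so this error bounds everything lost by truncating.\<close>

interpretation rs: lattice_ab_group_add_abs "rabs" "(+)" "0::'a::{ordered_real_vector,lattice}"
  "(-)" uminus "(\<le>)" "(<)" inf sup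
  by unfold_locales (rule rabs_def)

lemma rabs_le_iff: "rabs x \<le> y \<longleftrightarrow> x \<le> y \<and> - x \<le> (y::'a::{ordered_real_vector,lattice})"
  by (simp add: rabs_def)

lemma scaleR_sup:
  fixes x y :: "'a::{ordered_real_vector,lattice}"
  assumes "0 \<le> c"
  shows "c *\<^sub>R sup x y = sup (c *\<^sub>R x) (c *\<^sub>R y)"
proof (cases "c = 0")
  case False
  with assms have c: "0 < c" by simp
  show ?thesis
  proof (rule antisym)
    have "x \<le> inverse c *\<^sub>R sup (c *\<^sub>R x) (c *\<^sub>R y)"
      using scaleR_left_mono[of "c *\<^sub>R x" "sup (c *\<^sub>R x) (c *\<^sub>R y)" "inverse c"] c by simp
    moreover have "y \<le> inverse c *\<^sub>R sup (c *\<^sub>R x) (c *\<^sub>R y)"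
      using scaleR_left_mono[of "c *\<^sub>R y" "sup (c *\<^sub>R x) (c *\<^sub>R y)" "inverse c"] c by simp
    ultimately have "sup x y \<le> inverse c *\<^sub>R sup (c *\<^sub>R x) (c *\<^sub>R y)" by simp
    from scaleR_left_mono[OF this assms] c
    show "c *\<^sub>R sup x y \<le> sup (c *\<^sub>R x) (c *\<^sub>R y)" by simp
    show "sup (c *\<^sub>R x) (c *\<^sub>R y) \<le> c *\<^sub>R sup x y"
      using assms by (simp add: scaleR_left_mono)
  qed
qed simp

lemma scaleR_inf:
  fixes x y :: "'a::{ordered_real_vector,lattice}"
  assumes "0 \<le> c"
  shows "c *\<^sub>R inf x y = inf (c *\<^sub>R x) (c *\<^sub>R y)"
proof -
  have "c *\<^sub>R inf x y = - (c *\<^sub>R sup (- x) (- y))"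
    by (subst rs.inf_eq_neg_sup) (rule scaleR_minus_right)
  also have "\<dots> = - sup (- (c *\<^sub>R x)) (- (c *\<^sub>R y))" by (simp only: scaleR_sup[OF assms] scaleR_minus_right)
  also have "\<dots> = inf (c *\<^sub>R x) (c *\<^sub>R y)" by (rule rs.inf_eq_neg_sup[symmetric])
  finally show ?thesis .
qed

lemma rabs_scaleR: "rabs (c *\<^sub>R x) = \<bar>c\<bar> *\<^sub>R rabs (x::'a::{ordered_real_vector,lattice})"
proof (cases "0 \<le> c")
  case True
  then show ?thesis by (simp add: rabs_def scaleR_sup)
next
  case False
  then have "- c *\<^sub>R sup x (- x) = sup (- c *\<^sub>R x) (- c *\<^sub>R (- x))"
    by (intro scaleR_sup) simp
  with False show ?thesis by (simp add: rabs_def sup_commute)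
qed

text \<open>Congruence modulo an ideal is thereby compatible with \<open>sup\<close>. This gives
  closure of ideals under \<open>sup\<close> (with c = d = 0), and later the value of a character at
  \<open>sup f g\<close>.\<close>

lemma rabs_sup_diff_le:
  "rabs (sup a b - sup c d) \<le> rabs (a - c) + rabs (b - (d::'a::{ordered_real_vector,lattice}))"
proof -
  let ?d = "rabs (a - c) + rabs (b - d)"
  have "a - c \<le> ?d" "c - a \<le> ?d" "b - d \<le> ?d" "d - b \<le> ?d"
    using rs.abs_ge_self[of "a - c"] rs.abs_ge_minus_self[of "a - c"] rs.abs_ge_zero[of "b - d"]
      rs.abs_ge_self[of "b - d"] rs.abs_ge_minus_self[of "b - d"] rs.abs_ge_zero[of "a - c"]
      add_increasing add_increasing2
    by (metis minus_diff_eq)+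
  then have 1: "a \<le> c + ?d" "c \<le> a + ?d" and 2: "b \<le> d + ?d" "d \<le> b + ?d"
    by (simp_all only: diff_le_eq add.commute)
  have "sup a b \<le> sup (c + ?d) (d + ?d)" "sup c d \<le> sup (a + ?d) (b + ?d)"
    using 1 2 by (meson sup.mono)+
  then have "sup a b \<le> sup c d + ?d" "sup c d \<le> sup a b + ?d"
    by (simp_all only: rs.add_sup_distrib_right)
  then show ?thesis unfolding rabs_le_iff minus_diff_eq diff_le_eq by (simp only: add.commute simp_thms)
qed

lemma inf_add_le:
  fixes a b c :: "'a::{ordered_real_vector,lattice}"
  assumes "0 \<le> a" "0 \<le> b" "0 \<le> c"
  shows "inf (a + b) c \<le> inf a c + inf b c"
  unfolding rs.add_inf_distrib_left rs.add_inf_distrib_right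
  using assms by (auto intro: le_infI1 le_infI2 add_increasing add_increasing2)

lemma sup_zero_diff: "sup x 0 - sup (- x) 0 = (x::'a::{ordered_real_vector,lattice})"
proof -
  have "x + sup (- x) 0 = sup x 0" by (simp add: rs.add_sup_distrib_left sup_commute)
  then show ?thesis by (simp only: diff_eq_eq)
qed

lemma inf_pos_neg: "inf (sup x 0) (sup (- x) 0) = (0::'a::{ordered_real_vector,lattice})"
proof -
  have "sup x 0 = x + sup (- x) 0" using sup_zero_diff[of x] by (simp only: diff_eq_eq)
  moreover have "inf x 0 = - sup (- x) 0" by (simp only: rs.neg_sup_eq_inf minus_minus minus_zero)
  moreover have "inf (x + sup (- x) 0) (0 + sup (- x) 0) = inf x 0 + sup (- x) 0"
    by (simp only: rs.add_inf_distrib_right)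
  ultimately show ?thesis by (metis add.left_inverse add_0)
qed

text \<open>Dedekind completeness implies the Archimedean property: the supremum s of the multiples
  of x satisfies s \<le> s - x, because each multiple is the next one minus x.\<close>

lemma archimedean_le_zero:
  fixes x y :: "'a::{ordered_real_vector,conditionally_complete_lattice}"
  assumes "\<And>n::nat. real n *\<^sub>R x \<le> y"
  shows "x \<le> 0"
proof -
  let ?s = "SUP n. real n *\<^sub>R x"
  have bdd: "bdd_above (range (\<lambda>n. real n *\<^sub>R x))" using assms by (auto intro!: bdd_aboveI)
  have "real n *\<^sub>R x \<le> ?s - x" for n
    using cSUP_upper[OF _ bdd, of "Suc n"] by (simp add: algebra_simps)
  then have "?s \<le> ?s - x" by (intro cSUP_least) auto
  then show ?thesis by simp
qed

lemma archimedean_le: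
  fixes x y z :: "'a::{ordered_real_vector,conditionally_complete_lattice}"
  assumes "0 \<le> y" and le: "\<And>\<epsilon>. 0 < \<epsilon> \<Longrightarrow> x \<le> z + \<epsilon> *\<^sub>R y"
  shows "x \<le> z"
proof -
  have "real n *\<^sub>R (x - z) \<le> y" for n
  proof (cases "n = 0")
    case False
    then have "x - z \<le> (1 / real n) *\<^sub>R y" using le[of "1 / real n"] by (simp add: algebra_simps)
    from scaleR_left_mono[OF this, of "real n"] False show ?thesis by simp
  qed (use assms in simp)
  from archimedean_le_zero[OF this] show ?thesis by simp
qed

section \<open>Ideals, and maximal ideals missing a given element\<close>

lemma
  assumes "rs_ideal J"
  shows rs_ideal_zero: "0 \<in> J"
    and rs_ideal_add: "x \<in> J \<Longrightarrow> y \<in> J \<Longrightarrow> x + y \<in> J"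
    and rs_ideal_scaleR: "x \<in> J \<Longrightarrow> c *\<^sub>R x \<in> J"
    and rs_ideal_solid: "x \<in> J \<Longrightarrow> rabs y \<le> rabs x \<Longrightarrow> y \<in> J"
  using assms unfolding rs_ideal_def by auto

lemma rs_ideal_uminus: "rs_ideal J \<Longrightarrow> x \<in> J \<Longrightarrow> - x \<in> J"
  using rs_ideal_scaleR[of J x "-1"] by simp

lemma rs_ideal_diff: "rs_ideal J \<Longrightarrow> x \<in> J \<Longrightarrow> y \<in> J \<Longrightarrow> x - y \<in> J"
  using rs_ideal_add[of J x "- y"] rs_ideal_uminus by auto

lemma rs_ideal_rabs: "rs_ideal J \<Longrightarrow> x \<in> J \<Longrightarrow> rabs x \<in> J"
  by (rule rs_ideal_solid) auto

lemma rs_ideal_rabs_le: "rs_ideal J \<Longrightarrow> x \<in> J \<Longrightarrow> rabs y \<le> x \<Longrightarrow> y \<in> J"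
  by (meson order_trans rs.abs_ge_self rs_ideal_solid)

lemma rs_ideal_le: "rs_ideal J \<Longrightarrow> x \<in> J \<Longrightarrow> 0 \<le> y \<Longrightarrow> y \<le> x \<Longrightarrow> y \<in> J"
  by (rule rs_ideal_rabs_le) auto

lemma rs_ideal_sup: "rs_ideal J \<Longrightarrow> x \<in> J \<Longrightarrow> y \<in> J \<Longrightarrow> sup x y \<in> J"
proof (rule rs_ideal_rabs_le[of J "rabs x + rabs y"])
  show "rabs (sup x y) \<le> rabs x + rabs y" using rabs_sup_diff_le[of x y 0 0] by simp
qed (auto intro: rs_ideal_add rs_ideal_rabs)

lemma rs_ideal_inf: "rs_ideal J \<Longrightarrow> x \<in> J \<Longrightarrow> y \<in> J \<Longrightarrow> inf x y \<in> J"
  unfolding rs.inf_eq_neg_sup[of x y] by (intro rs_ideal_uminus rs_ideal_sup)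

text \<open>Maximality is among the ideals that miss \<open>e\<close>, not among proper ideals:
  enlarging \<open>M\<close> then always brings in \<open>e\<close>, which is the form used
  below.\<close>

lemma maximal_ideal_exists:
  fixes e :: "'a::{ordered_real_vector,lattice}"
  assumes "rs_ideal J" "e \<notin> J"
  obtains M where "rs_ideal M" "J \<subseteq> M" "e \<notin> M"
    "\<And>N. rs_ideal N \<Longrightarrow> M \<subseteq> N \<Longrightarrow> e \<notin> N \<Longrightarrow> N = M"
proof -
  let ?A = "{M. rs_ideal M \<and> J \<subseteq> M \<and> e \<notin> M}"
  have "\<exists>M\<in>?A. \<forall>X\<in>?A. M \<subseteq> X \<longrightarrow> X = M"
  proof (rule subset_Zorn_nonempty)
    show "?A \<noteq> {}" using assms by auto
    fix C assume ne: "C \<noteq> {}" and "subset.chain ?A C"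
    then have C: "C \<subseteq> ?A" and ch: "\<And>X Y. X \<in> C \<Longrightarrow> Y \<in> C \<Longrightarrow> X \<subseteq> Y \<or> Y \<subseteq> X"
      by (auto simp: subset.chain_def)
    have "rs_ideal (\<Union>C)"
      unfolding rs_ideal_def
    proof (intro conjI ballI allI impI)
      show "0 \<in> \<Union>C" using ne C rs_ideal_zero by blast
      show "x + y \<in> \<Union>C" if xy: "x \<in> \<Union>C" "y \<in> \<Union>C" for x y
      proof -
        obtain X Y where "X \<in> C" "Y \<in> C" "x \<in> X" "y \<in> Y" using xy by blast
        with ch[of X Y] obtain Z where "Z \<in> C" "x \<in> Z" "y \<in> Z" by blast
        with C rs_ideal_add[of Z x y] show ?thesis by blast
      qed
      show "c *\<^sub>R x \<in> \<Union>C" if "x \<in> \<Union>C" for x c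
        using that C rs_ideal_scaleR by blast
      show "y \<in> \<Union>C" if "x \<in> \<Union>C" "rabs y \<le> rabs x" for x y
        using that C rs_ideal_solid by blast
    qed
    with C ne show "\<Union>C \<in> ?A" by blast
  qed
  then obtain M where M: "M \<in> ?A" "\<forall>X\<in>?A. M \<subseteq> X \<longrightarrow> X = M" by (rule bexE)
  show ?thesis
  proof (rule that[of M])
    show "N = M" if "rs_ideal N" "M \<subseteq> N" "e \<notin> N" for N
      using M(1) that by (intro M(2)[rule_format]) auto
  qed (use M(1) in auto)
qed

text \<open>Only the values of \<open>\<phi>\<close> on the ideal \<open>Ee e\<close> matter.\<close>

definition character :: "'a::{ordered_real_vector,lattice} \<Rightarrow> ('a \<Rightarrow> real) \<Rightarrow> bool" where
  "character e \<phi> \<longleftrightarrow> \<phi> e = 1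
     \<and> (\<forall>f\<in>Ee e. \<forall>g\<in>Ee e. \<phi> (f + g) = \<phi> f + \<phi> g \<and> \<phi> (sup f g) = max (\<phi> f) (\<phi> g))
     \<and> (\<forall>f\<in>Ee e. \<forall>c. \<phi> (c *\<^sub>R f) = c * \<phi> f)"

text \<open>Positivity is all that is fixed here, so that \<open>Ee\<close> of another generator is
  also known to be an ideal; \<open>character_separates\<close> takes the generator
  \<open>sup (- g) 0\<close>. That \<open>e\<close> is a weak order unit is assumed separately where
  unbounded elements are handled.\<close>

locale unit_ideal =
  fixes e :: "'a::{ordered_real_vector,conditionally_complete_lattice}"
  assumes e_nonneg: "0 \<le> e"
begin

lemma rs_ideal_Ee: "rs_ideal (Ee e)"
  unfolding rs_ideal_def
proof (intro conjI ballI allI impI)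
  show "0 \<in> Ee e" using e_nonneg by (auto simp: Ee_def intro!: exI[of _ 1])
  show "x + y \<in> Ee e" if xy: "x \<in> Ee e" "y \<in> Ee e" for x y
  proof -
    obtain k l where "0 \<le> k" "rabs x \<le> k *\<^sub>R e" "0 \<le> l" "rabs y \<le> l *\<^sub>R e"
      using xy by (auto simp: Ee_def)
    then have "0 \<le> k + l \<and> rabs (x + y) \<le> (k + l) *\<^sub>R e"
      by (auto simp: scaleR_add_left intro: order_trans[OF rs.abs_triangle_ineq] add_mono)
    then show ?thesis unfolding Ee_def by blast
  qed
  show "c *\<^sub>R x \<in> Ee e" if x: "x \<in> Ee e" for x c
  proof -
    obtain k where "0 \<le> k" "rabs x \<le> k *\<^sub>R e" using x by (auto simp: Ee_def)
    then have "0 \<le> \<bar>c\<bar> * k \<and> rabs (c *\<^sub>R x) \<le> (\<bar>c\<bar> * k) *\<^sub>R e"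
      using scaleR_left_mono[of "rabs x" "k *\<^sub>R e" "\<bar>c\<bar>"] by (simp add: rabs_scaleR)
    then show ?thesis unfolding Ee_def by blast
  qed
  show "y \<in> Ee e" if "x \<in> Ee e" "rabs y \<le> rabs x" for x y
    using that by (auto simp: Ee_def intro: order_trans)
qed

lemmas Ee_zero [simp, intro] = rs_ideal_zero[OF rs_ideal_Ee]
  and Ee_add [simp, intro] = rs_ideal_add[OF rs_ideal_Ee]
  and Ee_scaleR [simp, intro] = rs_ideal_scaleR[OF rs_ideal_Ee]
  and Ee_uminus [simp, intro] = rs_ideal_uminus[OF rs_ideal_Ee]
  and Ee_diff [simp, intro] = rs_ideal_diff[OF rs_ideal_Ee]
  and Ee_rabs [simp, intro] = rs_ideal_rabs[OF rs_ideal_Ee]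
  and Ee_sup [simp, intro] = rs_ideal_sup[OF rs_ideal_Ee]
  and Ee_inf [simp, intro] = rs_ideal_inf[OF rs_ideal_Ee]
  and Ee_rabs_le = rs_ideal_rabs_le[OF rs_ideal_Ee]
  and Ee_le = rs_ideal_le[OF rs_ideal_Ee]

lemma Ee_unit [simp, intro]: "e \<in> Ee e"
  using e_nonneg by (auto simp: Ee_def intro!: exI[of _ 1])

lemma Ee_bound:
  assumes "f \<in> Ee e"
  obtains k where "0 < k" "rabs f \<le> k *\<^sub>R e" "f \<le> k *\<^sub>R e" "- f \<le> k *\<^sub>R e"
proof -
  obtain k where k: "0 \<le> k" "rabs f \<le> k *\<^sub>R e" using assms by (auto simp: Ee_def)
  have "k *\<^sub>R e \<le> (k + 1) *\<^sub>R e" using e_nonneg by (simp add: scaleR_add_left)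
  with k have "rabs f \<le> (k + 1) *\<^sub>R e" by (meson order_trans)
  with k that[of "k + 1"] show ?thesis by (auto simp: rabs_le_iff)
qed

section \<open>From maximal ideals to characters\<close>

context
  fixes M
  assumes ideal: "rs_ideal M" and enot: "e \<notin> M"
    and maxi: "\<And>N. rs_ideal N \<Longrightarrow> M \<subseteq> N \<Longrightarrow> e \<notin> N \<Longrightarrow> N = M"
begin

lemma maximal_absorb:
  assumes "0 \<le> u" "u \<notin> M"
  obtains m c where "m \<in> M" "0 \<le> m" "0 < c" "e \<le> m + c *\<^sub>R u"
proof -
  \<comment> \<open>The ideal generated by \<open>M\<close> and \<open>u\<close>; maximality forces
    it to contain \<open>e\<close>.\<close>
  let ?N = "{x. \<exists>m\<in>M. \<exists>c\<ge>0. 0 \<le> m \<and> rabs x \<le> m + c *\<^sub>R u}"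
  have "rs_ideal ?N"
    unfolding rs_ideal_def
  proof (intro conjI ballI allI impI)
    show "0 \<in> ?N" using rs_ideal_zero[OF ideal] by (auto intro!: bexI[of _ 0] exI[of _ 0])
    show "x + y \<in> ?N" if xy: "x \<in> ?N" "y \<in> ?N" for x y
    proof -
      obtain m c m' c' where "m \<in> M" "0 \<le> c" "0 \<le> m" "rabs x \<le> m + c *\<^sub>R u"
        "m' \<in> M" "0 \<le> c'" "0 \<le> m'" "rabs y \<le> m' + c' *\<^sub>R u" using xy by blast
      then have "m + m' \<in> M \<and> 0 \<le> c + c' \<and> 0 \<le> m + m' \<and> rabs (x + y) \<le> (m + m') + (c + c') *\<^sub>R u"
        using order_trans[OF rs.abs_triangle_ineq[of x y] add_mono, of "m + c *\<^sub>R u" "m' + c' *\<^sub>R u"]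
        by (auto intro: rs_ideal_add[OF ideal] simp: algebra_simps)
      then show ?thesis by blast
    qed
    show "d *\<^sub>R x \<in> ?N" if x: "x \<in> ?N" for x d
    proof -
      obtain m c where "m \<in> M" "0 \<le> c" "0 \<le> m" "rabs x \<le> m + c *\<^sub>R u" using x by blast
      then have "\<bar>d\<bar> *\<^sub>R m \<in> M \<and> 0 \<le> \<bar>d\<bar> * c \<and> 0 \<le> \<bar>d\<bar> *\<^sub>R m
          \<and> rabs (d *\<^sub>R x) \<le> \<bar>d\<bar> *\<^sub>R m + (\<bar>d\<bar> * c) *\<^sub>R u"
        using scaleR_left_mono[of "rabs x" "m + c *\<^sub>R u" "\<bar>d\<bar>"]
        by (auto intro: rs_ideal_scaleR[OF ideal] simp: rabs_scaleR algebra_simps scaleR_nonneg_nonneg)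
      then show ?thesis by blast
    qed
    show "y \<in> ?N" if "x \<in> ?N" "rabs y \<le> rabs x" for x y
      using that by (blast intro: order_trans)
  qed
  moreover have "M \<subseteq> ?N"
  proof
    fix x assume "x \<in> M"
    then have "rabs x \<in> M \<and> (0::real) \<le> 0 \<and> 0 \<le> rabs x \<and> rabs x \<le> rabs x + 0 *\<^sub>R u"
      using rs_ideal_rabs[OF ideal] by auto
    then show "x \<in> ?N" by blast
  qed
  moreover have "u \<in> ?N"
    using assms rs_ideal_zero[OF ideal] by (auto intro!: bexI[of _ 0] exI[of _ 1])
  ultimately have "e \<in> ?N" using maxi[of ?N] assms by blast
  then obtain m c where m: "m \<in> M" "0 \<le> c" "0 \<le> m" "rabs e \<le> m + c *\<^sub>R u" by blast
  \<comment> \<open>Passing from c to c + 1 makes the coefficient strictly positive.\<close>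
  have "m + c *\<^sub>R u \<le> m + (c + 1) *\<^sub>R u" using assms by (simp add: scaleR_add_left)
  with m that[of m "c + 1"] show ?thesis by (meson add_nonneg_pos order_trans rs.abs_ge_self zero_less_one)
qed

text \<open>If neither lay in \<open>M\<close>, both would absorb \<open>e\<close> up to elements of
  \<open>M\<close>; in the infimum of the two bounds the multiples of u and v vanish by
  disjointness, leaving \<open>e\<close> below an element of \<open>M\<close>.\<close>

lemma maximal_prime:
  assumes "0 \<le> u" "0 \<le> v" "inf u v = 0"
  shows "u \<in> M \<or> v \<in> M"
proof (rule ccontr)
  assume "\<not> (u \<in> M \<or> v \<in> M)"
  then obtain m c m' c' where m: "m \<in> M" "0 \<le> m" "0 < c" "e \<le> m + c *\<^sub>R u"
    "m' \<in> M" "0 \<le> m'" "0 < c'" "e \<le> m' + c' *\<^sub>R v"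
    using maximal_absorb assms by metis
  define K where "K = max c c'"
  have K: "0 \<le> K" using m by (simp add: K_def)
  have "c *\<^sub>R u \<le> K *\<^sub>R u" "c' *\<^sub>R v \<le> K *\<^sub>R v" using assms by (auto simp: K_def intro!: scaleR_right_mono)
  then have "m + c *\<^sub>R u \<le> (m + m') + K *\<^sub>R u" "m' + c' *\<^sub>R v \<le> (m + m') + K *\<^sub>R v"
    using m by (auto intro!: add_mono simp: add.assoc intro: add_increasing)
  then have "e \<le> inf ((m + m') + K *\<^sub>R u) ((m + m') + K *\<^sub>R v)" using m by (meson le_inf_iff order_trans)
  also have "\<dots> = (m + m') + K *\<^sub>R inf u v"
    by (simp add: rs.add_inf_distrib_left scaleR_inf[OF K])
  finally have "e \<le> m + m'" using assms by simp
  then show False using enot e_nonneg m rs_ideal_le[OF ideal] rs_ideal_add[OF ideal] by blast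
qed

lemma scaleR_unit_in_maximal: "t *\<^sub>R e \<in> M \<Longrightarrow> t = 0"
  using enot rs_ideal_scaleR[OF ideal, of "t *\<^sub>R e" "inverse t"] by (cases "t = 0") auto

text \<open>The value is a Dedekind cut: t is the supremum of those s with s e \<le> f modulo
  \<open>M\<close>. Above t this fails, and primeness then gives f \<le> (t + \<epsilon>) e modulo
  \<open>M\<close>. Hence f - t e is infinitesimal modulo \<open>M\<close>, and maximality rules out
  nonzero infinitesimals, since these could not absorb \<open>e\<close>.\<close>

lemma maximal_value_exists:
  assumes f: "f \<in> Ee e"
  obtains t where "f - t *\<^sub>R e \<in> M"
proof -
  obtain k where k: "0 < k" "rabs f \<le> k *\<^sub>R e" "f \<le> k *\<^sub>R e" "- f \<le> k *\<^sub>R e" using Ee_bound[OF f] .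
  let ?S = "{s. sup (s *\<^sub>R e - f) 0 \<in> M}"
  define t where "t = Sup ?S"
  have ub: "s \<le> k" if "s \<in> ?S" for s
  proof (rule ccontr)
    assume "\<not> s \<le> k"
    have "(s - k) *\<^sub>R e \<le> sup (s *\<^sub>R e - f) 0"
      using k by (intro le_supI1) (simp add: scaleR_diff_left algebra_simps)
    moreover have "0 \<le> (s - k) *\<^sub>R e" using \<open>\<not> s \<le> k\<close> e_nonneg by (simp add: scaleR_nonneg_nonneg)
    ultimately have "(s - k) *\<^sub>R e \<in> M" using that rs_ideal_le[OF ideal] by blast
    then show False using scaleR_unit_in_maximal[of "s - k"] \<open>\<not> s \<le> k\<close> by simp
  qed
  have bdd: "bdd_above ?S" using ub by (auto intro!: bdd_aboveI)
  have "(- k) *\<^sub>R e - f \<le> 0" using k by (simp add: minus_le_iff)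
  then have "sup ((- k) *\<^sub>R e - f) 0 = 0" by (rule sup_absorb2)
  then have ne: "- k \<in> ?S" using rs_ideal_zero[OF ideal] by simp
  have down: "s' \<in> ?S" if "s \<in> ?S" "s' \<le> s" for s s'
  proof -
    have "s' *\<^sub>R e - f \<le> s *\<^sub>R e - f" using that e_nonneg by (simp add: scaleR_right_mono)
    then have "sup (s' *\<^sub>R e - f) 0 \<le> sup (s *\<^sub>R e - f) 0" by (meson order_refl sup.mono)
    then show ?thesis using that rs_ideal_le[OF ideal] by simp
  qed
  have low: "sup ((t - \<epsilon>) *\<^sub>R e - f) 0 \<in> M" if "0 < \<epsilon>" for \<epsilon>
  proof -
    have "t - \<epsilon> < Sup ?S" using that by (simp add: t_def)
    then obtain s where "s \<in> ?S" "t - \<epsilon> < s" using ne by (blast elim: less_cSupE)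
    then show ?thesis using down by auto
  qed
  have high: "sup (f - (t + \<epsilon>) *\<^sub>R e) 0 \<in> M" if "0 < \<epsilon>" for \<epsilon>
  proof -
    have "t + \<epsilon> \<notin> ?S" using cSup_upper[OF _ bdd, of "t + \<epsilon>"] that by (auto simp: t_def)
    then show ?thesis
      using maximal_prime[of "sup ((t + \<epsilon>) *\<^sub>R e - f) 0" "sup (f - (t + \<epsilon>) *\<^sub>R e) 0"]
        inf_pos_neg[of "(t + \<epsilon>) *\<^sub>R e - f"] by auto
  qed
  have "rabs (f - t *\<^sub>R e) \<in> M"
  proof (rule ccontr)
    assume "rabs (f - t *\<^sub>R e) \<notin> M"
    then obtain m c where m: "m \<in> M" "0 \<le> m" "0 < c" "e \<le> m + c *\<^sub>R rabs (f - t *\<^sub>R e)"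
      using maximal_absorb[of "rabs (f - t *\<^sub>R e)"] by auto
    \<comment> \<open>With this \<epsilon> the term c \<epsilon> e is half of \<open>e\<close> and
      can be subtracted, leaving \<open>e\<close> below an element of \<open>M\<close>.\<close>
    define \<epsilon> where "\<epsilon> = 1 / (2 * c)"
    have \<epsilon>: "0 < \<epsilon>" "c * \<epsilon> = 1 / 2" using m by (auto simp: \<epsilon>_def)
    define a b where "a = sup ((t - \<epsilon>) *\<^sub>R e - f) 0" and "b = sup (f - (t + \<epsilon>) *\<^sub>R e) 0"
    have ab: "a \<in> M" "b \<in> M" "0 \<le> a" "0 \<le> b" using low[OF \<epsilon>(1)] high[OF \<epsilon>(1)] by (auto simp: a_def b_def)
    have "(t - \<epsilon>) *\<^sub>R e - f \<le> a" "f - (t + \<epsilon>) *\<^sub>R e \<le> b" by (auto simp: a_def b_def)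
    then have "t *\<^sub>R e - f \<le> a + \<epsilon> *\<^sub>R e" "f - t *\<^sub>R e \<le> b + \<epsilon> *\<^sub>R e" by (auto simp: algebra_simps)
    then have "rabs (f - t *\<^sub>R e) \<le> a + b + \<epsilon> *\<^sub>R e"
      using ab by (auto simp: rabs_le_iff intro: order_trans add_increasing add_increasing2)
    then have "c *\<^sub>R rabs (f - t *\<^sub>R e) \<le> c *\<^sub>R (a + b + \<epsilon> *\<^sub>R e)"
      using m by (intro scaleR_left_mono) auto
    then have "e \<le> m + c *\<^sub>R (a + b + \<epsilon> *\<^sub>R e)" using m by (meson add_left_mono order_trans)
    then have "e \<le> m + c *\<^sub>R (a + b) + (1/2) *\<^sub>R e" by (simp add: scaleR_add_right \<epsilon> add.assoc)
    then have "2 *\<^sub>R e \<le> 2 *\<^sub>R (m + c *\<^sub>R (a + b) + (1/2) *\<^sub>R e)" by (intro scaleR_left_mono) auto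
    then have "e + e \<le> 2 *\<^sub>R (m + c *\<^sub>R (a + b)) + e" by (simp add: scaleR_2 algebra_simps)
    then have "e \<le> 2 *\<^sub>R (m + c *\<^sub>R (a + b))" by simp
    moreover have "2 *\<^sub>R (m + c *\<^sub>R (a + b)) \<in> M"
      using m ab by (intro rs_ideal_scaleR[OF ideal] rs_ideal_add[OF ideal]) auto
    ultimately show False using enot e_nonneg rs_ideal_le[OF ideal] by blast
  qed
  then have "f - t *\<^sub>R e \<in> M" by (rule rs_ideal_rabs_le[OF ideal]) simp
  then show ?thesis by (rule that)
qed

text \<open>Every f in \<open>Ee e\<close> is congruent to exactly one multiple of \<open>e\<close>,
  so \<open>Ee e\<close> modulo \<open>M\<close> is the real line. Each law follows by exhibiting
  the right congruence and appealing to uniqueness, \<open>eq\<close>.\<close>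

lemma maximal_character:
  obtains \<phi> where "character e \<phi>" "\<And>f. f \<in> M \<Longrightarrow> \<phi> f = 0"
proof
  define \<phi> where "\<phi> f = (SOME t. f - t *\<^sub>R e \<in> M)" for f
  have eq: "\<phi> f = t" if "f - t *\<^sub>R e \<in> M" for f t
  proof -
    have "f - \<phi> f *\<^sub>R e \<in> M" unfolding \<phi>_def using that by (rule someI)
    from rs_ideal_diff[OF ideal that this] have "(\<phi> f - t) *\<^sub>R e \<in> M" by (simp add: algebra_simps)
    then show ?thesis using scaleR_unit_in_maximal by fastforce
  qed
  have mem: "f - \<phi> f *\<^sub>R e \<in> M" if "f \<in> Ee e" for f
    using maximal_value_exists[OF that] eq by metis
  show "character e \<phi>"
    unfolding character_def
  proof (intro conjI ballI allI)
    show "\<phi> e = 1" using rs_ideal_zero[OF ideal] by (intro eq) simp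
    fix f assume f: "f \<in> Ee e"
    show "\<phi> (c *\<^sub>R f) = c * \<phi> f" for c
      using rs_ideal_scaleR[OF ideal mem[OF f], of c] by (intro eq) (simp add: algebra_simps)
    fix g assume g: "g \<in> Ee e"
    show "\<phi> (f + g) = \<phi> f + \<phi> g"
      using rs_ideal_add[OF ideal mem[OF f] mem[OF g]] by (intro eq) (simp add: algebra_simps)
    have "max (\<phi> f) (\<phi> g) *\<^sub>R e = sup (\<phi> f *\<^sub>R e) (\<phi> g *\<^sub>R e)"
    proof (cases "\<phi> f \<le> \<phi> g")
      case True
      then show ?thesis using e_nonneg by (simp add: max_def sup_absorb2 scaleR_right_mono)
    next
      case False
      then show ?thesis using e_nonneg by (simp add: max_def sup_absorb1 scaleR_right_mono)
    qed
    then show "\<phi> (sup f g) = max (\<phi> f) (\<phi> g)"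
      using rabs_sup_diff_le[of f g "\<phi> f *\<^sub>R e" "\<phi> g *\<^sub>R e"]
        rs_ideal_add[OF ideal rs_ideal_rabs[OF ideal mem[OF f]] rs_ideal_rabs[OF ideal mem[OF g]]]
      by (intro eq) (auto intro: rs_ideal_rabs_le[OF ideal])
  qed
  show "\<phi> f = 0" if "f \<in> M" for f using that by (intro eq) simp
qed

end

end

section \<open>Band projections\<close>

lemma disj_complD: "x \<in> disj_compl A \<Longrightarrow> y \<in> A \<Longrightarrow> inf (rabs x) (rabs y) = 0"
  by (simp add: disj_compl_def)

lemma inf_rabs_eq_zeroI:
  "inf (rabs x) (rabs y) \<le> 0 \<Longrightarrow> inf (rabs x) (rabs (y::'a::{ordered_real_vector,lattice})) = 0"
  by (rule antisym) simp_all

lemma rs_ideal_disj_compl: "rs_ideal (disj_compl A)"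
  unfolding rs_ideal_def
proof (intro conjI ballI allI impI)
  show "0 \<in> disj_compl A" by (auto simp: disj_compl_def intro: inf_absorb1)
  show "x + y \<in> disj_compl A" if "x \<in> disj_compl A" "y \<in> disj_compl A" for x y
    unfolding disj_compl_def mem_Collect_eq
  proof
    fix z assume z: "z \<in> A"
    have "inf (rabs (x + y)) (rabs z) \<le> inf (rabs x + rabs y) (rabs z)"
      by (meson inf_mono order_refl rs.abs_triangle_ineq)
    also have "\<dots> \<le> inf (rabs x) (rabs z) + inf (rabs y) (rabs z)" by (rule inf_add_le) auto
    also have "\<dots> = 0" using that z by (simp add: disj_complD)
    finally show "inf (rabs (x + y)) (rabs z) = 0" by (rule inf_rabs_eq_zeroI)
  qed
  show "c *\<^sub>R x \<in> disj_compl A" if "x \<in> disj_compl A" for x c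
    unfolding disj_compl_def mem_Collect_eq
  proof
    fix z assume z: "z \<in> A"
    \<comment> \<open>\<open>scaleR_inf\<close> works with one common factor, so both arguments are
      enlarged to the factor \<open>d\<close>.\<close>
    define d where "d = max \<bar>c\<bar> 1"
    have "\<bar>c\<bar> *\<^sub>R rabs x \<le> d *\<^sub>R rabs x" "1 *\<^sub>R rabs z \<le> d *\<^sub>R rabs z"
      by (auto simp: d_def simp del: scaleR_one intro!: scaleR_right_mono)
    then have "inf (rabs (c *\<^sub>R x)) (rabs z) \<le> inf (d *\<^sub>R rabs x) (d *\<^sub>R rabs z)"
      unfolding rabs_scaleR scaleR_one by (rule inf_mono)
    also have "\<dots> = d *\<^sub>R inf (rabs x) (rabs z)" by (simp add: scaleR_inf d_def)
    also have "\<dots> = 0" using that z by (simp add: disj_complD)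
    finally show "inf (rabs (c *\<^sub>R x)) (rabs z) = 0" by (rule inf_rabs_eq_zeroI)
  qed
  show "y \<in> disj_compl A" if "x \<in> disj_compl A" "rabs y \<le> rabs x" for x y
    unfolding disj_compl_def mem_Collect_eq
  proof
    fix z assume z: "z \<in> A"
    have "inf (rabs y) (rabs z) \<le> inf (rabs x) (rabs z)" using that by (intro inf_mono) auto
    also have "\<dots> = 0" using that z by (simp add: disj_complD)
    finally show "inf (rabs y) (rabs z) = 0" by (rule inf_rabs_eq_zeroI)
  qed
qed

text \<open>A translation argument takes the place of infinite distributivity: the part w that
  \<open>sup s 0\<close> shares with |y| is disjoint from the positive part of every x in X, so x
  \<le> \<open>sup s 0 - w\<close>. Then also s \<le> \<open>sup s 0 - w\<close>, whence w = 0. The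
  negative part of s is below |x| for any single member x.\<close>

lemma rs_band_disj_compl:
  "rs_band (disj_compl (A :: 'a::{ordered_real_vector,conditionally_complete_lattice} set))"
  unfolding rs_band_def
proof (intro conjI allI impI rs_ideal_disj_compl)
  fix X assume "X \<subseteq> disj_compl A \<and> X \<noteq> {} \<and> bdd_above X"
  then have X: "X \<subseteq> disj_compl A" and bdd: "bdd_above X" and ne: "X \<noteq> {}" by auto
  define s where "s = Sup X"
  have up: "x \<le> s" if "x \<in> X" for x using that bdd by (simp add: s_def cSup_upper)
  have "sup s 0 \<in> disj_compl A"
    unfolding disj_compl_def mem_Collect_eq
  proof
    fix y assume y: "y \<in> A"
    define w where "w = inf (sup s 0) (rabs y)"
    have w: "0 \<le> w" "w \<le> sup s 0" by (auto simp: w_def)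
    have "x \<le> sup s 0 - w" if x: "x \<in> X" for x
    proof -
      have "inf (sup x 0) w \<le> inf (rabs x) (rabs y)"
        by (rule inf_mono) (simp_all add: w_def rs.abs_ge_self)
      also have "\<dots> = 0" using X x y by (auto dest: disj_complD)
      finally have "inf (sup x 0) w = 0" using w by (intro antisym) auto
      then have "sup x 0 + w = sup (sup x 0) w" using rs.add_eq_inf_sup[of "sup x 0" w] by simp
      also have "\<dots> \<le> sup s 0" using up[OF x] w by (auto intro: le_supI1)
      finally have "sup x 0 \<le> sup s 0 - w" by (simp only: le_diff_eq)
      then show ?thesis by simp
    qed
    then have "s \<le> sup s 0 - w" unfolding s_def using ne by (intro cSup_least) auto
    moreover have "0 \<le> sup s 0 - w" using w by simp
    ultimately have "sup s 0 \<le> sup s 0 - w" by (rule sup_least)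
    then have "w \<le> 0" by (simp only: le_diff_eq add_le_same_cancel1)
    then have "w = 0" using w(1) by (rule antisym)
    then show "inf (rabs (sup s 0)) (rabs y) = 0" by (simp add: w_def)
  qed
  moreover obtain x where x: "x \<in> X" using ne by auto
  ultimately have "sup s 0 + rabs x \<in> disj_compl A"
    using X by (auto intro: rs_ideal_add[OF rs_ideal_disj_compl] rs_ideal_rabs[OF rs_ideal_disj_compl])
  moreover have "rabs s \<le> sup s 0 + rabs x"
  proof -
    have "- s \<le> rabs x" using up[OF x] by (meson neg_le_iff_le order_trans rs.abs_ge_minus_self)
    then have "- s \<le> sup s 0 + rabs x" by (rule order_trans) (simp add: add_increasing)
    moreover have "s \<le> sup s 0 + rabs x" by (rule order_trans[OF sup_ge1[of s 0]]) simp
    ultimately show ?thesis by (simp only: rabs_le_iff)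
  qed
  ultimately show "Sup X \<in> disj_compl A"
    unfolding s_def[symmetric] by (rule rs_ideal_rabs_le[OF rs_ideal_disj_compl])
qed

lemma rs_band_Sup: "rs_band B \<Longrightarrow> A \<subseteq> B \<Longrightarrow> A \<noteq> {} \<Longrightarrow> bdd_above A \<Longrightarrow> Sup A \<in> B"
  by (simp add: rs_band_def)

text \<open>For positive x the component p is the largest element of the band below x: anything that
  x - p shares with an element of the band could be added to p, so it is 0. The general case
  subtracts the components of the positive and negative parts.\<close>

lemma rs_band_decomp:
  fixes B :: "'a::{ordered_real_vector,conditionally_complete_lattice} set"
  assumes B: "rs_band B"
  shows "\<exists>p\<in>B. x - p \<in> disj_compl B"
proof -
  have id: "rs_ideal B" using B by (simp add: rs_band_def)
  have pos: "\<exists>p\<in>B. x - p \<in> disj_compl B" if x: "0 \<le> x" for x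
  proof -
    let ?Y = "{y\<in>B. 0 \<le> y \<and> y \<le> x}"
    define p where "p = Sup ?Y"
    have bdd: "bdd_above ?Y" by (auto intro!: bdd_aboveI)
    have ne: "0 \<in> ?Y" using x rs_ideal_zero[OF id] by simp
    have "?Y \<noteq> {}" using ne by auto
    then have p: "p \<in> B" unfolding p_def using bdd by (intro rs_band_Sup[OF B]) auto
    have p0: "0 \<le> p" unfolding p_def by (rule cSup_upper[OF ne bdd])
    have px: "p \<le> x" unfolding p_def using ne by (intro cSup_least) auto
    have "x - p \<in> disj_compl B"
      unfolding disj_compl_def mem_Collect_eq
    proof
      fix b assume b: "b \<in> B"
      define w where "w = inf (x - p) (rabs b)"
      have w: "0 \<le> w" "w \<le> x - p" "w \<le> rabs b" using px by (auto simp: w_def)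
      have "w \<in> B" using rs_ideal_le[OF id rs_ideal_rabs[OF id b]] w by blast
      then have "p + w \<in> B" using p rs_ideal_add[OF id] by blast
      moreover have "p + w \<le> x" using w by (simp only: le_diff_eq add.commute)
      moreover have "0 \<le> p + w" using p0 w by (simp only: add_nonneg_nonneg)
      ultimately have "p + w \<in> ?Y" by blast
      then have "p + w \<le> p" unfolding p_def by (rule cSup_upper[OF _ bdd])
      then have "w = 0" using w by (intro antisym) auto
      then show "inf (rabs (x - p)) (rabs b) = 0" using px by (simp add: w_def)
    qed
    with p show ?thesis by blast
  qed
  obtain p q where pq: "p \<in> B" "sup x 0 - p \<in> disj_compl B" "q \<in> B" "sup (- x) 0 - q \<in> disj_compl B"
    using pos[of "sup x 0"] pos[of "sup (- x) 0"] by auto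
  have swap: "(a - b) - (c - d) = (a - c) - (b - d)" for a b c d :: 'a by simp
  have "x - (p - q) = (sup x 0 - sup (- x) 0) - (p - q)" by (simp only: sup_zero_diff)
  also have "\<dots> = (sup x 0 - p) - (sup (- x) 0 - q)" by (rule swap)
  finally have "x - (p - q) \<in> disj_compl B"
    using rs_ideal_diff[OF rs_ideal_disj_compl pq(2,4)] by (simp only:)
  then show ?thesis using rs_ideal_diff[OF id pq(1,3)] by blast
qed

lemma rs_band_projection_exists:
  assumes "rs_band B"
  obtains P where "band_projection P" "\<And>x. P x \<in> B" "\<And>x. x - P x \<in> disj_compl B"
  using rs_band_decomp[OF assms] assms unfolding band_projection_def by metis

locale band_proj =
  fixes P :: "'a::{ordered_real_vector,conditionally_complete_lattice} \<Rightarrow> 'a" and B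
  assumes band: "rs_band B" and in_band: "P x \<in> B" and compl: "x - P x \<in> disj_compl B"
begin

lemma ideal: "rs_ideal B" using band by (simp add: rs_band_def)

text \<open>The difference of two candidates lies in the band and in its disjoint complement, hence
  is disjoint from itself.\<close>

lemma eqI:
  assumes "y \<in> B" "x - y \<in> disj_compl B"
  shows "P x = y"
proof -
  have "y - P x \<in> B" using assms in_band rs_ideal_diff[OF ideal] by blast
  moreover have "y - P x \<in> disj_compl B"
    using rs_ideal_diff[OF rs_ideal_disj_compl compl[of x] assms(2)] by simp
  ultimately have "inf (rabs (y - P x)) (rabs (y - P x)) = 0" by (metis disj_complD)
  then show ?thesis by simp
qed

lemma linear_P: "linear P"
proof
  show "P (x + y) = P x + P y" for x y
    using rs_ideal_add[OF rs_ideal_disj_compl compl[of x] compl[of y]]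
    by (intro eqI rs_ideal_add[OF ideal] in_band) (simp add: add_diff_add)
  show "P (c *\<^sub>R x) = c *\<^sub>R P x" for c x
    using rs_ideal_scaleR[OF rs_ideal_disj_compl compl[of x], of c]
    by (intro eqI rs_ideal_scaleR[OF ideal] in_band) (simp add: scaleR_diff_right)
qed

lemma disjoint: "inf (rabs (P x)) (rabs (y - P y)) = 0"
  by (metis compl in_band disj_complD inf_commute)

text \<open>For positive x, - P x \<le> x - P x, so the negative part of P x is below both of two
  disjoint elements. \<open>le_self\<close> treats the negative part of x - P x in the same
  way.\<close>

lemma nonneg: 
  assumes "0 \<le> x" shows "0 \<le> P x"
proof -
  have "sup (- P x) 0 \<le> inf (rabs (P x)) (rabs (x - P x))"
  proof (intro le_infI le_supI)
    show "- P x \<le> rabs (x - P x)"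
      using assms by (intro order_trans[OF _ rs.abs_ge_self]) simp
  qed (auto simp: rs.abs_ge_minus_self)
  then show ?thesis by (simp add: disjoint)
qed

lemma le_self:
  assumes "0 \<le> x" shows "P x \<le> x"
proof -
  have "sup (P x - x) 0 \<le> inf (rabs (P x)) (rabs (x - P x))"
  proof (intro le_infI le_supI)
    show "P x - x \<le> rabs (P x)"
      using assms by (intro order_trans[OF _ rs.abs_ge_self]) simp
    show "P x - x \<le> rabs (x - P x)" by (metis rs.abs_ge_minus_self minus_diff_eq)
  qed auto
  then show ?thesis by (simp add: disjoint)
qed

end

lemma band_projE:
  assumes "band_projection P"
  obtains B where "band_proj P B"
  using assms unfolding band_projection_def by (meson band_proj.intro)

lemma
  assumes "band_projection P"
  shows band_projection_linear: "linear P"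
    and band_projection_nonneg: "0 \<le> x \<Longrightarrow> 0 \<le> P x"
    and band_projection_le: "0 \<le> x \<Longrightarrow> P x \<le> x"
    and band_projection_disjoint: "inf (rabs (P x)) (rabs (y - P y)) = 0"
  using assms band_proj.linear_P band_proj.nonneg band_proj.le_self band_proj.disjoint
  by (metis band_projE)+

lemma band_projection_mono:
  assumes "band_projection P" "x \<le> y"
  shows "P x \<le> P y"
  using band_projection_nonneg[OF assms(1), of "y - x"] assms(2)
  by (simp add: linear_diff[OF band_projection_linear[OF assms(1)]])

text \<open>Applied to a difference, this projection serves as the indicator of one element
  exceeding another. The double disjoint complement of \<open>sup a 0\<close> is a band without
  further construction, contains \<open>sup a 0\<close>, and is disjoint from the negative part of
  a.\<close>

lemma pos_part_projection:
  fixes a :: "'a::{ordered_real_vector,conditionally_complete_lattice}"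
  obtains P where "band_projection P" "P a = sup a 0"
proof -
  let ?C = "disj_compl {sup a 0}"
  obtain P where P: "band_projection P" "\<And>x. P x \<in> disj_compl ?C" "\<And>x. x - P x \<in> disj_compl (disj_compl ?C)"
    using rs_band_projection_exists[OF rs_band_disj_compl[of ?C]] by blast
  interpret band_proj P "disj_compl ?C" using P rs_band_disj_compl by unfold_locales auto
  have "P a = sup a 0"
  proof (rule eqI)
    show "sup a 0 \<in> disj_compl ?C" by (simp add: disj_compl_def inf_commute)
    have "a - sup a 0 = - sup (- a) 0" using sup_zero_diff[of a] by (metis diff_eq_eq add_diff_cancel_left' minus_diff_eq)
    moreover have "sup (- a) 0 \<in> ?C" using inf_pos_neg[of a] by (simp add: disj_compl_def inf_commute)
    ultimately have "a - sup a 0 \<in> ?C" using rs_ideal_uminus[OF rs_ideal_disj_compl] by metis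
    then show "a - sup a 0 \<in> disj_compl (disj_compl ?C)" 
      by (subst disj_compl_def) (auto dest: disj_complD simp: inf_commute)
  qed
  with P that show ?thesis by blast
qed

section \<open>Separation by characters and the product\<close>

context unit_ideal
begin

lemma
  assumes "character e \<phi>"
  shows character_unit: "\<phi> e = 1"
    and character_add: "f \<in> Ee e \<Longrightarrow> g \<in> Ee e \<Longrightarrow> \<phi> (f + g) = \<phi> f + \<phi> g"
    and character_sup: "f \<in> Ee e \<Longrightarrow> g \<in> Ee e \<Longrightarrow> \<phi> (sup f g) = max (\<phi> f) (\<phi> g)"
    and character_scaleR: "f \<in> Ee e \<Longrightarrow> \<phi> (c *\<^sub>R f) = c * \<phi> f"
  using assms by (auto simp: character_def)

lemma character_zero: "character e \<phi> \<Longrightarrow> \<phi> 0 = 0"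
  using character_scaleR[of \<phi> 0 0] by simp

lemma character_uminus: "character e \<phi> \<Longrightarrow> f \<in> Ee e \<Longrightarrow> \<phi> (- f) = - \<phi> f"
  using character_scaleR[of \<phi> f "-1"] by simp

lemma character_diff:
  "character e \<phi> \<Longrightarrow> f \<in> Ee e \<Longrightarrow> g \<in> Ee e \<Longrightarrow> \<phi> (f - g) = \<phi> f - \<phi> g"
  using character_add[of \<phi> f "- g"] by (simp add: character_uminus)

lemma character_inf:
  "character e \<phi> \<Longrightarrow> f \<in> Ee e \<Longrightarrow> g \<in> Ee e \<Longrightarrow> \<phi> (inf f g) = min (\<phi> f) (\<phi> g)"
  unfolding rs.inf_eq_neg_sup[of f g]
  by (simp add: character_uminus character_sup rs_ideal_sup[OF rs_ideal_Ee] del: rs.neg_sup_eq_inf)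

lemma character_rabs: "character e \<phi> \<Longrightarrow> f \<in> Ee e \<Longrightarrow> \<phi> (rabs f) = \<bar>\<phi> f\<bar>"
  unfolding rabs_def by (simp add: character_uminus character_sup)

lemma character_mono:
  "character e \<phi> \<Longrightarrow> f \<in> Ee e \<Longrightarrow> g \<in> Ee e \<Longrightarrow> f \<le> g \<Longrightarrow> \<phi> f \<le> \<phi> g"
  using character_sup[of \<phi> f g] by (simp add: sup_absorb2)

lemma character_nonneg: "character e \<phi> \<Longrightarrow> f \<in> Ee e \<Longrightarrow> 0 \<le> f \<Longrightarrow> 0 \<le> \<phi> f"
  using character_mono[of \<phi> 0 f] by (simp add: character_zero)

lemmas character_simps = character_unit character_zero character_add character_diff character_uminus
  character_scaleR character_sup character_inf character_rabs

text \<open>The negative part v of f is shown to be below \<epsilon> e for every \<epsilon>. Let g =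
  v - \<epsilon> e. Either some character annihilates the negative part of g; its value at v is then
  at least \<epsilon>, although its value at f is nonnegative. Or the negative part of g dominates a
  positive multiple of \<open>e\<close>, hence a positive multiple of the positive part of g, which
  is disjoint from it and so must vanish.\<close>

lemma character_separates:
  assumes f: "f \<in> Ee e" and pos: "\<And>\<phi>. character e \<phi> \<Longrightarrow> 0 \<le> \<phi> f"
  shows "0 \<le> f"
proof -
  define v where "v = sup (- f) 0"
  have v: "v \<in> Ee e" "0 \<le> v" using f by (auto simp: v_def)
  have "v \<le> \<epsilon> *\<^sub>R e" if \<epsilon>: "0 < \<epsilon>" for \<epsilon>
  proof -
    define g where "g = v - \<epsilon> *\<^sub>R e"
    have g: "g \<in> Ee e" using v by (simp add: g_def)
    let ?J = "{x. \<exists>c\<ge>0. rabs x \<le> c *\<^sub>R sup (- g) 0}"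
    have "e \<in> ?J"
    proof (rule ccontr)
      assume "e \<notin> ?J"
      moreover have "rs_ideal ?J"
        using unit_ideal.rs_ideal_Ee[of "sup (- g) 0"] by (simp add: unit_ideal_def Ee_def)
      ultimately obtain M where M: "rs_ideal M" "?J \<subseteq> M" "e \<notin> M"
        "\<And>N. rs_ideal N \<Longrightarrow> M \<subseteq> N \<Longrightarrow> e \<notin> N \<Longrightarrow> N = M"
        using maximal_ideal_exists[of ?J e] by auto
      from maximal_character[OF M(1,3,4)] obtain \<phi> where
        \<phi>: "character e \<phi>" "\<And>f. f \<in> M \<Longrightarrow> \<phi> f = 0" by blast
      have "sup (- g) 0 \<in> ?J" by (auto intro!: exI[of _ 1])
      then have "\<phi> (sup (- g) 0) = 0" using M \<phi> by blast
      then have "0 \<le> \<phi> g" using g \<phi> by (simp add: character_simps[OF \<phi>(1)])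
      then have "\<epsilon> \<le> \<phi> v" using v by (simp add: g_def character_simps[OF \<phi>(1)])
      moreover have "\<phi> v \<le> 0" using pos[OF \<phi>(1)] f by (simp add: v_def character_simps[OF \<phi>(1)])
      ultimately show False using \<epsilon> by simp
    qed
    then obtain c where c: "0 \<le> c" "e \<le> c *\<^sub>R sup (- g) 0" using e_nonneg by auto
    obtain k where k: "0 < k" "rabs (sup g 0) \<le> k *\<^sub>R e" using Ee_bound[of "sup g 0"] g by auto
    \<comment> \<open>d \<ge> 1 puts both disjoint parts of g under the same factor, so that their
      infimum can be taken.\<close>
    define d where "d = max 1 (k * c)"
    have "sup g 0 \<le> k *\<^sub>R e" using k by simp
    also have "\<dots> \<le> k *\<^sub>R (c *\<^sub>R sup (- g) 0)" using k c by (intro scaleR_left_mono) auto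
    also have "\<dots> \<le> d *\<^sub>R sup (- g) 0" by (auto simp: d_def intro!: scaleR_right_mono)
    finally have 1: "sup g 0 \<le> d *\<^sub>R sup (- g) 0" .
    have "1 *\<^sub>R sup g 0 \<le> d *\<^sub>R sup g 0" by (intro scaleR_right_mono) (auto simp: d_def)
    then have "sup g 0 \<le> inf (d *\<^sub>R sup g 0) (d *\<^sub>R sup (- g) 0)" using 1 by simp
    also have "\<dots> = d *\<^sub>R inf (sup g 0) (sup (- g) 0)" by (simp add: scaleR_inf d_def)
    also have "\<dots> = 0" by (simp only: inf_pos_neg scaleR_zero_right)
    finally have "g \<le> 0" by simp
    then show ?thesis by (simp add: g_def)
  qed
  then have "v \<le> 0" using archimedean_le[of e v 0] e_nonneg by simp
  then show ?thesis by (simp add: v_def)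
qed

lemma character_leI:
  assumes "f \<in> Ee e" "g \<in> Ee e" "\<And>\<phi>. character e \<phi> \<Longrightarrow> \<phi> f \<le> \<phi> g"
  shows "f \<le> g"
  using character_separates[of "g - f"] assms(1,2) assms(3) by (simp add: character_diff)

lemma character_eqI:
  assumes "f \<in> Ee e" "g \<in> Ee e" "\<And>\<phi>. character e \<phi> \<Longrightarrow> \<phi> f = \<phi> g"
  shows "f = g"
  using assms by (intro antisym character_leI) (simp_all add: assms(3))

section \<open>Band projections under characters\<close>

lemma Ee_band_unit:
  assumes "band_projection P" shows "P e \<in> Ee e"
  using band_projection_nonneg[OF assms e_nonneg] band_projection_le[OF assms e_nonneg] Ee_le by blast

lemma Ee_band_image:
  assumes "band_projection P" "f \<in> Ee e" shows "P f \<in> Ee e"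
proof -
  have "P (rabs f) \<in> Ee e"
    using band_projection_nonneg[OF assms(1) rs.abs_ge_zero] band_projection_le[OF assms(1) rs.abs_ge_zero]
      assms(2) by (blast intro: Ee_le[OF Ee_rabs])
  moreover have "rabs (P f) \<le> P (rabs f)"
    using band_projection_mono[OF assms(1), of f "rabs f"] band_projection_mono[OF assms(1), of "- f" "rabs f"]
    by (simp add: rabs_le_iff linear_neg[OF band_projection_linear[OF assms(1)]] rs.abs_ge_minus_self rs.abs_ge_self)
  ultimately show ?thesis by (rule Ee_rabs_le)
qed

text \<open>\<open>P e\<close> and \<open>e - P e\<close> are disjoint, so a character annihilates
  one of them, and with it P f or f - P f, which are bounded by its multiples. Band projections thus
  become multiplication by 0 or 1, and case distinctions on this value replace arguments with
  bands.\<close>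

lemma character_band_projection:
  assumes P: "band_projection P" and \<phi>: "character e \<phi>" and f: "f \<in> Ee e"
  shows "\<phi> (P e) \<in> {0, 1}" "\<phi> (P f) = \<phi> (P e) * \<phi> f"
proof -
  note lin = band_projection_linear[OF P]
  have Pe: "P e \<in> Ee e" and PfE: "P f \<in> Ee e" using P f Ee_band_unit Ee_band_image by blast+
  obtain k where k: "0 < k" "rabs f \<le> k *\<^sub>R e" "f \<le> k *\<^sub>R e" "- f \<le> k *\<^sub>R e" using Ee_bound[OF f] .
  have "P f \<le> P (k *\<^sub>R e)" "P (- f) \<le> P (k *\<^sub>R e)" using k band_projection_mono[OF P] by blast+
  then have Pf: "rabs (P f) \<le> k *\<^sub>R P e"
    by (simp add: rabs_le_iff linear_cmul[OF lin] linear_neg[OF lin])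
  have "0 \<le> k *\<^sub>R e - f" "0 \<le> k *\<^sub>R e + f"
    using k(3) add_right_mono[OF k(4), of f] by simp_all
  from this[THEN band_projection_le[OF P]]
  have "0 \<le> k *\<^sub>R e - f - P (k *\<^sub>R e - f)" "0 \<le> k *\<^sub>R e + f - P (k *\<^sub>R e + f)"
    by simp_all
  then have Qf: "rabs (f - P f) \<le> k *\<^sub>R (e - P e)"
    unfolding rabs_le_iff
    by (simp add: linear_cmul[OF lin] linear_diff[OF lin] linear_add[OF lin] algebra_simps)
  have "inf (rabs (P e)) (rabs (e - P e)) = 0" by (rule band_projection_disjoint[OF P])
  then have "\<phi> (inf (rabs (P e)) (rabs (e - P e))) = 0" by (simp add: character_zero[OF \<phi>])
  then have "min \<bar>\<phi> (P e)\<bar> \<bar>1 - \<phi> (P e)\<bar> = 0"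
    using Pe by (simp add: character_simps[OF \<phi>])
  then show 01: "\<phi> (P e) \<in> {0, 1}" by (auto simp: min_def split: if_splits)
  have "\<bar>\<phi> (P f)\<bar> \<le> k * \<phi> (P e)" "\<bar>\<phi> f - \<phi> (P f)\<bar> \<le> k * (1 - \<phi> (P e))"
    using character_mono[OF \<phi> _ _ Pf] character_mono[OF \<phi> _ _ Qf] Pe PfE f
    by (simp_all add: character_simps[OF \<phi>])
  then show "\<phi> (P f) = \<phi> (P e) * \<phi> f" using 01 by auto
qed

text \<open>The square is the supremum of its tangents \<open>2 a f - a\<^sup>2 e\<close>. Characters need not commute with
  suprema, but near a given character with value \<open>t\<close> at \<open>f\<close> the tangents are dominated by
  \<open>t\<^sup>2 e\<close> plus a multiple of \<open>\<bar>f - t e\<bar>\<close>, which that character annihilates.\<close>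

lemma square_exists:
  assumes f: "f \<in> Ee e"
  obtains s where "s \<in> Ee e" "\<And>\<phi>. character e \<phi> \<Longrightarrow> \<phi> s = (\<phi> f)\<^sup>2"
proof -
  obtain k where k: "0 < k" "rabs f \<le> k *\<^sub>R e" using Ee_bound[OF f] by metis
  have bnd: "\<bar>\<phi> f\<bar> \<le> k" if "character e \<phi>" for \<phi>
    using character_mono[OF that _ _ k(2)] f by (simp add: character_simps[OF that])
  define F where "F a = (2 * a) *\<^sub>R f - a\<^sup>2 *\<^sub>R e" for a
  define s where "s = (SUP a\<in>{-k..k}. F a)"
  have FE: "F a \<in> Ee e" for a using f by (simp add: F_def)
  have \<phi>F: "\<phi> (F a) = 2 * a * \<phi> f - a\<^sup>2" if "character e \<phi>" for \<phi> a
    using f by (simp add: F_def character_simps[OF that])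
  have main: "F a \<le> t\<^sup>2 *\<^sub>R e + (2 * k) *\<^sub>R rabs (f - t *\<^sub>R e)" if a: "a \<in> {-k..k}" for a t
  proof (rule character_leI)
    fix \<phi> assume \<phi>: "character e \<phi>"
    have "a * (\<phi> f - t) \<le> \<bar>a\<bar> * \<bar>\<phi> f - t\<bar>" by (metis abs_ge_self abs_mult)
    also have "\<dots> \<le> k * \<bar>\<phi> f - t\<bar>" using a by (intro mult_right_mono) auto
    finally have "2 * a * \<phi> f - a\<^sup>2 \<le> t\<^sup>2 + 2 * k * \<bar>\<phi> f - t\<bar>"
      using zero_le_power2[of "a - t"] by (simp add: power2_eq_square algebra_simps)
    then show "\<phi> (F a) \<le> \<phi> (t\<^sup>2 *\<^sub>R e + (2 * k) *\<^sub>R rabs (f - t *\<^sub>R e))"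
      using f by (simp add: \<phi>F[OF \<phi>] character_simps[OF \<phi>])
  qed (use f FE in auto)
  have bdd: "bdd_above (F ` {-k..k})" by (rule bdd_aboveI2[OF main[where t = 0]])
  have up: "F a \<le> s" if "a \<in> {-k..k}" for a unfolding s_def using that bdd by (rule cSUP_upper)
  have least: "s \<le> t\<^sup>2 *\<^sub>R e + (2 * k) *\<^sub>R rabs (f - t *\<^sub>R e)" for t
    unfolding s_def using main k by (intro cSUP_least) auto
  have s0: "0 \<le> s" using up[of 0] k by (simp add: F_def)
  have sE: "s \<in> Ee e" by (rule Ee_le[OF _ s0 least[of 0]]) (use f in simp)
  have "\<phi> s = (\<phi> f)\<^sup>2" if \<phi>: "character e \<phi>" for \<phi>
  proof -
    define t where "t = \<phi> f"
    have "t \<in> {-k..k}" using bnd[OF \<phi>] by (auto simp: t_def)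
    from character_mono[OF \<phi> FE sE up[OF this]] character_mono[OF \<phi> sE _ least[of t]] f
    show ?thesis by (simp add: \<phi>F[OF \<phi>] character_simps[OF \<phi>] t_def power2_eq_square)
  qed
  with sE show ?thesis by (rule that)
qed

text \<open>Polarisation from the squares of f + g and f - g.\<close>

lemma product_exists:
  assumes f: "f \<in> Ee e" and g: "g \<in> Ee e"
  shows "\<exists>p. p \<in> Ee e \<and> (\<forall>\<phi>. character e \<phi> \<longrightarrow> \<phi> p = \<phi> f * \<phi> g)"
proof -
  obtain s where s: "s \<in> Ee e" "\<And>\<phi>. character e \<phi> \<Longrightarrow> \<phi> s = (\<phi> (f + g))\<^sup>2"
    using square_exists[of "f + g"] f g by auto
  obtain d where d: "d \<in> Ee e" "\<And>\<phi>. character e \<phi> \<Longrightarrow> \<phi> d = (\<phi> (f - g))\<^sup>2"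
    using square_exists[of "f - g"] f g by auto
  have "\<phi> ((1/4) *\<^sub>R (s - d)) = \<phi> f * \<phi> g" if \<phi>: "character e \<phi>" for \<phi>
    using f g s(1) d(1)
    by (simp add: character_simps[OF \<phi>] s(2)[OF \<phi>] d(2)[OF \<phi>] power2_eq_square algebra_simps)
  then show ?thesis using s d by (intro exI[of _ "(1/4) *\<^sub>R (s - d)"]) auto
qed

text \<open>If |f| \<le> k e, then |\<phi> (m f h)| \<le> k \<phi> h for positive h. So
  multiplication by f maps elements on which \<phi> vanishes to such elements, since \<phi> vanishes
  on their positive and negative parts too. Writing g as \<phi> g times \<open>e\<close> plus such
  an element reduces the claim to the unit law. This is what makes the product unique.\<close>

lemma character_falg_mult:
  assumes m: "falg_mult (Ee e) e m" and f: "f \<in> Ee e" and g: "g \<in> Ee e" and \<phi>: "character e \<phi>"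
  shows "\<phi> (m f g) = \<phi> f * \<phi> g"
proof -
  have clos: "m f g \<in> Ee e" if "f \<in> Ee e" "g \<in> Ee e" for f g
    using m that by (simp add: falg_mult_def)
  have lin1: "m (a *\<^sub>R f + b *\<^sub>R g) h = a *\<^sub>R m f h + b *\<^sub>R m g h"
    and lin2: "m h (a *\<^sub>R f + b *\<^sub>R g) = a *\<^sub>R m h f + b *\<^sub>R m h g"
    if "f \<in> Ee e" "g \<in> Ee e" "h \<in> Ee e" for f g h a b
  proof -
    have "\<forall>f\<in>Ee e. \<forall>g\<in>Ee e. \<forall>h\<in>Ee e. \<forall>a b. m (a *\<^sub>R f + b *\<^sub>R g) h = a *\<^sub>R m f h + b *\<^sub>R m g h
        \<and> m h (a *\<^sub>R f + b *\<^sub>R g) = a *\<^sub>R m h f + b *\<^sub>R m h g"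
      using m unfolding falg_mult_def by (elim conjE) assumption
    with that show "m (a *\<^sub>R f + b *\<^sub>R g) h = a *\<^sub>R m f h + b *\<^sub>R m g h"
      "m h (a *\<^sub>R f + b *\<^sub>R g) = a *\<^sub>R m h f + b *\<^sub>R m h g" by simp_all
  qed
  have pos: "0 \<le> m f g" if "f \<in> Ee e" "g \<in> Ee e" "0 \<le> f" "0 \<le> g" for f g
    using m that by (simp add: falg_mult_def)
  have unit: "m e f = f" "m f e = f" if "f \<in> Ee e" for f
    using m that by (simp_all add: falg_mult_def)
  obtain k where k: "0 < k" "rabs f \<le> k *\<^sub>R e" "f \<le> k *\<^sub>R e" "- f \<le> k *\<^sub>R e" using Ee_bound[OF f] .
  have bound: "\<bar>\<phi> (m f h)\<bar> \<le> k * \<phi> h" if h: "h \<in> Ee e" "0 \<le> h" for h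
  proof -
    have "0 \<le> k *\<^sub>R e + (-1) *\<^sub>R f" "0 \<le> k *\<^sub>R e + 1 *\<^sub>R f"
      using k(3) add_right_mono[OF k(4), of f] by simp_all
    then have "0 \<le> m (k *\<^sub>R e + (-1) *\<^sub>R f) h" "0 \<le> m (k *\<^sub>R e + 1 *\<^sub>R f) h"
      using h f by (intro pos; simp)+
    then have "0 \<le> k *\<^sub>R h + (-1) *\<^sub>R m f h" "0 \<le> k *\<^sub>R h + 1 *\<^sub>R m f h"
      using h f by (simp_all only: lin1 unit Ee_unit)
    then show ?thesis using h f clos
      character_nonneg[OF \<phi>, of "k *\<^sub>R h + (-1) *\<^sub>R m f h"] character_nonneg[OF \<phi>, of "k *\<^sub>R h + 1 *\<^sub>R m f h"]
      by (simp add: character_simps[OF \<phi>])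
  qed
  define h where "h = g - \<phi> g *\<^sub>R e"
  define u where "u = sup h 0"
  define v where "v = sup (- h) 0"
  have h: "h \<in> Ee e" "\<phi> h = 0" using g by (auto simp: h_def character_simps[OF \<phi>])
  have uv: "u \<in> Ee e" "v \<in> Ee e" "0 \<le> u" "0 \<le> v" "\<phi> u = 0" "\<phi> v = 0"
    using h by (auto simp: u_def v_def character_simps[OF \<phi>])
  have "\<phi> (m f u) = 0" "\<phi> (m f v) = 0" using bound[of u] bound[of v] uv by auto
  moreover have "m f h = 1 *\<^sub>R m f u + (-1) *\<^sub>R m f v"
    using lin2[of u v f 1 "-1"] uv f sup_zero_diff[of h] by (simp add: u_def v_def)
  ultimately have "\<phi> (m f h) = 0" using uv f clos by (simp add: character_simps[OF \<phi>])
  moreover have "m f g = 1 *\<^sub>R m f h + \<phi> g *\<^sub>R m f e"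
    using lin2[of h e f 1 "\<phi> g"] h f by (simp add: h_def)
  ultimately show ?thesis using h f clos by (simp add: unit character_simps[OF \<phi>])
qed

text \<open>Separation reduces each axiom to a fact about real numbers. The choice by
  \<open>SOME\<close> is unambiguous for the same reason: two candidates agree under all
  characters.\<close>

lemma falg_mult_exists: "\<exists>m. falg_mult (Ee e) e m"
proof -
  define m where "m f g = (if f \<in> Ee e \<and> g \<in> Ee e
    then SOME p. p \<in> Ee e \<and> (\<forall>\<phi>. character e \<phi> \<longrightarrow> \<phi> p = \<phi> f * \<phi> g) else 0)" for f g
  have m: "m f g \<in> Ee e \<and> (\<forall>\<phi>. character e \<phi> \<longrightarrow> \<phi> (m f g) = \<phi> f * \<phi> g)"
    if "f \<in> Ee e" "g \<in> Ee e" for f g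
  proof -
    have "m f g = (SOME p. p \<in> Ee e \<and> (\<forall>\<phi>. character e \<phi> \<longrightarrow> \<phi> p = \<phi> f * \<phi> g))"
      using that by (simp add: m_def)
    then show ?thesis using someI_ex[OF product_exists[OF that]] by (rule ssubst)
  qed
  have mE [simp]: "m f g \<in> Ee e" if "f \<in> Ee e" "g \<in> Ee e" for f g using m that by blast
  have m\<phi>: "\<phi> (m f g) = \<phi> f * \<phi> g" if "character e \<phi>" "f \<in> Ee e" "g \<in> Ee e" for f g \<phi>
    using m that by blast
  have "falg_mult (Ee e) e m"
    unfolding falg_mult_def
  proof (intro conjI ballI allI impI)
    show "m f g = 0" if "f \<notin> Ee e \<or> g \<notin> Ee e" for f g using that by (auto simp: m_def)
  next
    fix P Q :: "'a \<Rightarrow> 'a" assume PQ: "band_projection P \<and> band_projection Q"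
    then have E: "P e \<in> Ee e" "Q e \<in> Ee e" by (auto intro: Ee_band_unit)
    show "m (P e) (Q e) = P (Q e)"
    proof (rule character_eqI)
      show "P (Q e) \<in> Ee e" using PQ E Ee_band_image by blast
      show "\<phi> (m (P e) (Q e)) = \<phi> (P (Q e))" if \<phi>: "character e \<phi>" for \<phi>
        using PQ E character_band_projection[of P \<phi> "Q e"] \<phi> by (simp add: m\<phi>[OF \<phi>])
    qed (use E in simp)
  next
    fix f assume f: "f \<in> Ee e"
    show "m e f = f"
      by (rule character_eqI) (use f in \<open>simp_all add: m\<phi> character_unit\<close>)
    show "m f e = f"
      by (rule character_eqI) (use f in \<open>simp_all add: m\<phi> character_unit\<close>)
    fix g assume g: "g \<in> Ee e"
    show "m f g \<in> Ee e" using f g by simp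
    show "0 \<le> m f g" if "0 \<le> f \<and> 0 \<le> g"
    proof (rule character_separates)
      show "0 \<le> \<phi> (m f g)" if \<phi>: "character e \<phi>" for \<phi>
        using \<open>0 \<le> f \<and> 0 \<le> g\<close> f g character_nonneg[OF \<phi>] by (simp add: m\<phi>[OF \<phi>])
    qed (use f g in simp)
    fix h assume h: "h \<in> Ee e"
    show "m (m f g) h = m f (m g h)"
    proof (rule character_eqI)
      show "\<phi> (m (m f g) h) = \<phi> (m f (m g h))" if \<phi>: "character e \<phi>" for \<phi>
        using f g h by (simp add: m\<phi>[OF \<phi>])
    qed (use f g h in simp_all)
    show "m (a *\<^sub>R f + b *\<^sub>R g) h = a *\<^sub>R m f h + b *\<^sub>R m g h" for a b
    proof (rule character_eqI)
      show "\<phi> (m (a *\<^sub>R f + b *\<^sub>R g) h) = \<phi> (a *\<^sub>R m f h + b *\<^sub>R m g h)" if \<phi>: "character e \<phi>" for \<phi>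
        using f g h by (simp add: m\<phi>[OF \<phi>] character_simps[OF \<phi>] algebra_simps)
    qed (use f g h in simp_all)
    show "m h (a *\<^sub>R f + b *\<^sub>R g) = a *\<^sub>R m h f + b *\<^sub>R m h g" for a b
    proof (rule character_eqI)
      show "\<phi> (m h (a *\<^sub>R f + b *\<^sub>R g)) = \<phi> (a *\<^sub>R m h f + b *\<^sub>R m h g)" if \<phi>: "character e \<phi>" for \<phi>
        using f g h by (simp add: m\<phi>[OF \<phi>] character_simps[OF \<phi>] algebra_simps)
    qed (use f g h in simp_all)
    assume a: "inf f g = 0 \<and> 0 \<le> f \<and> 0 \<le> g \<and> 0 \<le> h"
    \<comment> \<open>Disjointness means that under each character one of the two values is 0, and
      multiplication by \<phi> h preserves this.\<close>
    have min0: "min (\<phi> h * \<phi> f) (\<phi> g) = 0" if \<phi>: "character e \<phi>" for \<phi>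
    proof -
      have "\<phi> (inf f g) = 0" using a by (simp add: character_zero[OF \<phi>])
      then have "min (\<phi> f) (\<phi> g) = 0" using f g by (simp add: character_inf[OF \<phi>])
      moreover have "0 \<le> \<phi> f" "0 \<le> \<phi> g" "0 \<le> \<phi> h" using a f g h character_nonneg[OF \<phi>] by blast+
      ultimately show ?thesis by (auto simp: min_def not_le mult_le_0_iff split: if_splits)
    qed
    show "inf (m h f) g = 0"
    proof (rule character_eqI)
      show "\<phi> (inf (m h f) g) = \<phi> 0" if \<phi>: "character e \<phi>" for \<phi>
        using f g h min0[OF \<phi>] by (simp add: m\<phi>[OF \<phi>] character_simps[OF \<phi>])
    qed (use f g h in simp_all)
    show "inf (m f h) g = 0"
    proof (rule character_eqI)
      show "\<phi> (inf (m f h) g) = \<phi> 0" if \<phi>: "character e \<phi>" for \<phi>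
        using f g h min0[OF \<phi>] by (simp add: m\<phi>[OF \<phi>] character_simps[OF \<phi>] mult.commute)
    qed (use f g h in simp_all)
  qed
  then show ?thesis by blast
qed

lemma falg_mult_unique:
  assumes m: "falg_mult (Ee e) e m" and m': "falg_mult (Ee e) e m'"
  shows "m f g = m' f g"
proof (cases "f \<in> Ee e \<and> g \<in> Ee e")
  case True
  then have fg: "f \<in> Ee e" "g \<in> Ee e" by auto
  show ?thesis
  proof (rule character_eqI)
    show "m f g \<in> Ee e" "m' f g \<in> Ee e" using m m' fg by (auto simp: falg_mult_def)
    show "\<phi> (m f g) = \<phi> (m' f g)" if "character e \<phi>" for \<phi>
      by (simp only: character_falg_mult[OF m fg that] character_falg_mult[OF m' fg that])
  qed
next
  case False
  then show ?thesis using m m' by (simp add: falg_mult_def)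
qed

lemma falg_mult_emult: "falg_mult (Ee e) e (emult e)"
  unfolding emult_def
proof (rule theI'[where P = "falg_mult (Ee e) e"])
  show "\<exists>!m. falg_mult (Ee e) e m"
    using falg_mult_exists falg_mult_unique by (intro ex_ex1I ext) auto
qed

lemma emult_in_Ee [simp, intro]: "f \<in> Ee e \<Longrightarrow> g \<in> Ee e \<Longrightarrow> emult e f g \<in> Ee e"
  using falg_mult_emult by (simp add: falg_mult_def)

lemma character_emult:
  "character e \<phi> \<Longrightarrow> f \<in> Ee e \<Longrightarrow> g \<in> Ee e \<Longrightarrow> \<phi> (emult e f g) = \<phi> f * \<phi> g"
  using character_falg_mult[OF falg_mult_emult] by blast

end

section \<open>Order convergence to zero\<close>

text \<open>The infimum is expressed through lower bounds because \<open>INF\<close> in a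
  conditionally complete lattice is informative only once boundedness is known; in this form a lower
  bound can be moved across inequalities directly.\<close>

definition down_zero :: "(nat \<Rightarrow> 'a::{ordered_real_vector,conditionally_complete_lattice}) \<Rightarrow> bool" where
  "down_zero p \<longleftrightarrow> decseq p \<and> (\<forall>n. 0 \<le> p n) \<and> (\<forall>l. (\<forall>n. l \<le> p n) \<longrightarrow> l \<le> 0)"

lemma
  assumes "down_zero p"
  shows down_zero_le: "m \<le> n \<Longrightarrow> p n \<le> p m"
    and down_zero_nonneg: "0 \<le> p n"
    and down_zero_lower: "(\<And>n. l \<le> p n) \<Longrightarrow> l \<le> 0"
  using assms by (auto simp: down_zero_def decseq_def)

lemma down_zeroI:
  assumes "\<And>n. p (Suc n) \<le> p n" "\<And>n. 0 \<le> p n" "\<And>l. (\<And>n. l \<le> p n) \<Longrightarrow> l \<le> 0"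
  shows "down_zero p"
  using assms by (simp add: down_zero_def decseq_Suc_iff)

lemma down_zero_iff_INF:
  "down_zero p \<longleftrightarrow> decseq p \<and> (\<forall>n. 0 \<le> p n) \<and> (INF n. p n) = 0"
proof (cases "\<forall>n. 0 \<le> p n")
  case True
  then have bdd: "bdd_below (range p)" by (auto intro!: bdd_belowI)
  have "(\<forall>l. (\<forall>n. l \<le> p n) \<longrightarrow> l \<le> 0) \<longleftrightarrow> (INF n. p n) = 0"
  proof
    assume *: "\<forall>l. (\<forall>n. l \<le> p n) \<longrightarrow> l \<le> 0"
    have "(INF n. p n) \<le> 0" using * cINF_lower[OF bdd] by simp
    moreover have "0 \<le> (INF n. p n)" using True by (intro cINF_greatest) auto
    ultimately show "(INF n. p n) = 0" by (rule antisym)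
  next
    assume 0: "(INF n. p n) = 0"
    show "\<forall>l. (\<forall>n. l \<le> p n) \<longrightarrow> l \<le> 0"
      using cINF_greatest[of UNIV _ p] unfolding 0 by simp
  qed
  with True show ?thesis by (simp add: down_zero_def)
qed (auto simp: down_zero_def)

lemma order_conv_zero_iff: "order_conv x 0 \<longleftrightarrow> (\<exists>p. down_zero p \<and> (\<forall>n. rabs (x n) \<le> p n))"
proof -
  have "0 \<le> p n" if "\<forall>n. rabs (x n) \<le> p n" for p n
    using that rs.abs_ge_zero order_trans by blast
  then show ?thesis unfolding order_conv_def down_zero_iff_INF by (auto simp only: diff_zero)
qed

lemma order_conv_zeroI: "down_zero p \<Longrightarrow> (\<And>n. rabs (x n) \<le> p n) \<Longrightarrow> order_conv x 0"
  by (auto simp only: order_conv_zero_iff)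

lemma order_conv_zeroE:
  assumes "order_conv x 0"
  obtains p where "down_zero p" "\<And>n. rabs (x n) \<le> p n"
  using assms by (auto simp only: order_conv_zero_iff)

lemma order_conv_zero_mono:
  assumes "order_conv y 0" "\<And>n. rabs (x n) \<le> rabs (y n)"
  shows "order_conv x 0"
  using assms by (meson order_conv_zero_iff order_trans)

text \<open>Monotonicity at max n m gives l \<le> p n + q m for independent n and m, so the two
  infima can be taken one after the other.\<close>

lemma down_zero_add:
  assumes p: "down_zero p" and q: "down_zero q"
  shows "down_zero (\<lambda>n. p n + q n)"
proof (rule down_zeroI)
  show "p (Suc n) + q (Suc n) \<le> p n + q n" for n
    using p q by (intro add_mono down_zero_le) auto
  show "0 \<le> p n + q n" for n using p q by (intro add_nonneg_nonneg down_zero_nonneg)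
  fix l assume l: "\<And>n. l \<le> p n + q n"
  show "l \<le> 0"
  proof (rule down_zero_lower[OF q])
    fix m
    have "l - q m \<le> 0"
    proof (rule down_zero_lower[OF p])
      fix n
      have "l \<le> p (max n m) + q (max n m)" by (rule l)
      also have "\<dots> \<le> p n + q m" by (intro add_mono down_zero_le[OF p] down_zero_le[OF q]) auto
      finally show "l - q m \<le> p n" by (simp only: diff_le_eq)
    qed
    then show "l \<le> q m" by (simp only: diff_le_eq add_0)
  qed
qed

lemma down_zero_scaleR:
  assumes p: "down_zero p" and c: "0 \<le> c"
  shows "down_zero (\<lambda>n. c *\<^sub>R p n)"
proof (rule down_zeroI)
  show "c *\<^sub>R p (Suc n) \<le> c *\<^sub>R p n" for n
    using c by (intro scaleR_left_mono down_zero_le[OF p]) auto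
  show "0 \<le> c *\<^sub>R p n" for n using c down_zero_nonneg[OF p] by (rule scaleR_nonneg_nonneg)
  fix l assume l: "\<And>n. l \<le> c *\<^sub>R p n"
  show "l \<le> 0"
  proof (cases "c = 0")
    case False
    with c have c': "0 < c" by simp
    have "inverse c *\<^sub>R l \<le> 0"
    proof (rule down_zero_lower[OF p])
      show "inverse c *\<^sub>R l \<le> p n" for n
        using scaleR_left_mono[OF l[of n], of "inverse c"] c' by simp
    qed
    from scaleR_left_mono[OF this c] c' show ?thesis by simp
  qed (use l in simp)
qed

lemma order_conv_zero_add:
  assumes "order_conv x 0" "order_conv y 0"
  shows "order_conv (\<lambda>n. x n + y n) 0"
proof -
  obtain p where p: "down_zero p" "\<And>n. rabs (x n) \<le> p n" using assms(1) by (rule order_conv_zeroE) blast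
  obtain q where q: "down_zero q" "\<And>n. rabs (y n) \<le> q n" using assms(2) by (rule order_conv_zeroE) blast
  show ?thesis
    by (rule order_conv_zeroI[OF down_zero_add[OF p(1) q(1)]])
      (rule order_trans[OF rs.abs_triangle_ineq add_mono[OF p(2) q(2)]])
qed

lemma order_conv_zero_scaleR:
  assumes "order_conv x 0"
  shows "order_conv (\<lambda>n. c *\<^sub>R x n) 0"
proof -
  obtain p where p: "down_zero p" "\<And>n. rabs (x n) \<le> p n" using assms by (rule order_conv_zeroE) blast
  show ?thesis
    by (rule order_conv_zeroI[OF down_zero_scaleR[OF p(1), of "\<bar>c\<bar>"]])
      (simp_all add: rabs_scaleR scaleR_left_mono p(2))
qed

text \<open>Each \<epsilon> comes with its own dominating sequence, whereas order convergence asks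
  for a single one. The tail suprema of |x| are below all of these bounds at once, so a lower bound
  of the tails is at most \<epsilon> u for every \<epsilon>.\<close>

lemma order_conv_zero_approx:
  fixes x :: "nat \<Rightarrow> 'a::{ordered_real_vector,conditionally_complete_lattice}"
  assumes u: "0 \<le> u"
    and approx: "\<And>\<epsilon>. 0 < \<epsilon> \<Longrightarrow> \<exists>y. order_conv y 0 \<and> (\<forall>n. rabs (x n) \<le> y n + \<epsilon> *\<^sub>R u)"
  shows "order_conv x 0"
proof -
  have ex: "\<exists>p. down_zero p \<and> (\<forall>n. rabs (x n) \<le> p n + \<epsilon> *\<^sub>R u)" if \<epsilon>: "0 < \<epsilon>" for \<epsilon>
  proof -
    obtain y where y: "order_conv y 0" "\<And>n. rabs (x n) \<le> y n + \<epsilon> *\<^sub>R u" using approx[OF \<epsilon>] by blast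
    obtain p where p: "down_zero p" "\<And>n. rabs (y n) \<le> p n" using y(1) by (rule order_conv_zeroE) blast
    have "rabs (x n) \<le> p n + \<epsilon> *\<^sub>R u" for n
      by (rule order_trans[OF y(2) add_right_mono]) (rule order_trans[OF rs.abs_ge_self p(2)])
    with p(1) show ?thesis by blast
  qed
  define s where "s n = (SUP j\<in>{n..}. rabs (x j))" for n
  have sle: "s n \<le> p n + \<epsilon> *\<^sub>R u" if p: "down_zero p" "\<And>n. rabs (x n) \<le> p n + \<epsilon> *\<^sub>R u" for p \<epsilon> n
    unfolding s_def
    by (rule cSUP_least) (auto intro!: order_trans[OF p(2)] add_right_mono down_zero_le[OF p(1)])
  obtain p1 where p1: "down_zero p1" "\<And>n. rabs (x n) \<le> p1 n + 1 *\<^sub>R u" using ex[of 1] by auto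
  have bdd: "bdd_above ((\<lambda>j. rabs (x j)) ` {n..})" for n
  proof (rule bdd_aboveI2)
    show "rabs (x j) \<le> p1 0 + 1 *\<^sub>R u" for j
      by (rule order_trans[OF p1(2) add_right_mono[OF down_zero_le[OF p1(1)]]]) simp
  qed
  have upper: "rabs (x n) \<le> s n" for n unfolding s_def by (rule cSUP_upper[OF _ bdd]) simp
  have "down_zero s"
  proof (rule down_zeroI)
    show "s (Suc n) \<le> s n" for n
      unfolding s_def by (rule cSUP_subset_mono) (auto simp: bdd)
    show "0 \<le> s n" for n by (rule order_trans[OF rs.abs_ge_zero upper])
    fix l assume l: "\<And>n. l \<le> s n"
    show "l \<le> 0"
    proof (rule archimedean_le[OF u])
      fix \<epsilon> :: real assume "0 < \<epsilon>"
      from ex[OF this] obtain p where p: "down_zero p" "\<And>n. rabs (x n) \<le> p n + \<epsilon> *\<^sub>R u" by blast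
      have "l - \<epsilon> *\<^sub>R u \<le> 0"
      proof (rule down_zero_lower[OF p(1)])
        show "l - \<epsilon> *\<^sub>R u \<le> p n" for n
          unfolding diff_le_eq by (rule order_trans[OF l sle[OF p]])
      qed
      then show "l \<le> 0 + \<epsilon> *\<^sub>R u" by (simp only: diff_le_eq)
    qed
  qed
  then show ?thesis using upper by (rule order_conv_zeroI)
qed

section \<open>Cesaro means\<close>

abbreviation (input) cesaro :: "(nat \<Rightarrow> 'a::real_vector) \<Rightarrow> nat \<Rightarrow> 'a" where
  "cesaro x n \<equiv> (1 / real n) *\<^sub>R (\<Sum>k<n. x k)"

lemma cesaro_mono:
  assumes "\<And>k. x k \<le> (y k :: 'a::ordered_real_vector)"
  shows "cesaro x n \<le> cesaro y n"
  by (intro scaleR_left_mono sum_mono assms) simp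

lemma cesaro_nonneg: "(\<And>k. 0 \<le> (x k :: 'a::ordered_real_vector)) \<Longrightarrow> 0 \<le> cesaro x n"
  by (intro scaleR_nonneg_nonneg sum_nonneg) simp_all

text \<open>Since 1 / 0 = 0, the mean at n = 0 is 0; nonnegativity of c covers this case.\<close>

lemma cesaro_le:
  assumes "\<And>k. x k \<le> (c :: 'a::ordered_real_vector)" "0 \<le> c"
  shows "cesaro x n \<le> c"
proof (cases "n = 0")
  case False
  have "(\<Sum>k<n. x k) \<le> real n *\<^sub>R c"
    using sum_mono[of "{..<n}" x "\<lambda>_. c"] assms(1) by (simp add: sum_constant_scaleR)
  from scaleR_left_mono[OF this, of "1 / real n"] False show ?thesis by simp
qed (use assms in simp)

lemma cesaro_add: "cesaro (\<lambda>k. x k + y k) n = cesaro x n + cesaro y n"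
  by (simp add: sum.distrib scaleR_add_right)

lemma cesaro_scaleR: "cesaro (\<lambda>k. c *\<^sub>R x k) n = c *\<^sub>R cesaro x n"
  by (simp add: scaleR_sum_right[symmetric] mult.commute)

text \<open>The value p 0 replaces the mean at n = 0, which is 0 and would break monotonicity. The
  means decrease because the next term is at most the mean of its predecessors. For a lower bound l,
  n l is at most m p 0 + n p m: the first m terms are a fixed error, which the Archimedean property
  removes.\<close>

lemma down_zero_cesaro:
  assumes p: "down_zero p"
  shows "down_zero (\<lambda>n. if n = 0 then p 0 else cesaro p n)" (is "down_zero ?q")
proof (rule down_zeroI)
  show "0 \<le> ?q n" for n using down_zero_nonneg[OF p] cesaro_nonneg[of p n] by simp
  show "?q (Suc n) \<le> ?q n" for n
  proof (cases "n = 0")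
    case False
    define s where "s = (\<Sum>k<n. p k)"
    have "(\<Sum>k<n. p n) \<le> s" unfolding s_def by (intro sum_mono down_zero_le[OF p]) simp
    then have "real n *\<^sub>R p n \<le> s" by (simp only: sum_constant_scaleR card_lessThan)
    from scaleR_left_mono[OF this, of "1 / real n"] False have "p n \<le> (1 / real n) *\<^sub>R s" by simp
    then have "s + p n \<le> s + (1 / real n) *\<^sub>R s" by (rule add_left_mono)
    also have "\<dots> = (1 + 1 / real n) *\<^sub>R s" by (simp only: scaleR_add_left scaleR_one)
    also have "1 + 1 / real n = real (Suc n) / real n" using False by (simp add: field_simps)
    finally have "s + p n \<le> (real (Suc n) / real n) *\<^sub>R s" .
    from scaleR_left_mono[OF this, of "1 / real (Suc n)"] False
    have "(1 / real (Suc n)) *\<^sub>R (s + p n) \<le> (1 / real n) *\<^sub>R s" by simp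
    with False show ?thesis by (simp only: s_def sum.lessThan_Suc nat.simps if_False)
  qed simp
  fix l assume l: "\<And>n. l \<le> ?q n"
  show "l \<le> 0"
  proof (rule down_zero_lower[OF p])
    fix m
    have "l - p m \<le> 0"
    proof (rule archimedean_le_zero)
      fix n
      show "real n *\<^sub>R (l - p m) \<le> real m *\<^sub>R p 0"
      proof (cases "n = 0")
        case False
        have "p k \<le> (if k < m then p 0 else 0) + p m" for k
          using down_zero_le[OF p, of 0 k] down_zero_le[OF p, of m k] down_zero_nonneg[OF p]
          by (auto intro: add_increasing2)
        then have "(\<Sum>k<n. p k) \<le> (\<Sum>k<n. (if k < m then p 0 else 0) + p m)" by (intro sum_mono)
        also have "\<dots> = (\<Sum>k\<in>{..<n} \<inter> {..<m}. p 0) + real n *\<^sub>R p m"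
          using sum.inter_restrict[of "{..<n}" "\<lambda>_. p 0" "{..<m}"]
          by (simp add: sum.distrib sum_constant_scaleR del: lessThan_Int_lessThan)
        also have "(\<Sum>k\<in>{..<n} \<inter> {..<m}. p 0) \<le> real m *\<^sub>R p 0"
          using down_zero_nonneg[OF p] card_mono[of "{..<m}" "{..<n} \<inter> {..<m}"]
          by (simp add: sum_constant_scaleR scaleR_right_mono del: lessThan_Int_lessThan)
        finally have "(\<Sum>k<n. p k) \<le> real m *\<^sub>R p 0 + real n *\<^sub>R p m" by simp
        moreover have "real n *\<^sub>R l \<le> (\<Sum>k<n. p k)"
          using scaleR_left_mono[OF l[of n], of "real n"] False by simp
        ultimately have "real n *\<^sub>R l \<le> real m *\<^sub>R p 0 + real n *\<^sub>R p m" by (rule order_trans[rotated])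
        then show ?thesis by (simp only: scaleR_diff_right diff_le_eq)
      qed (use down_zero_nonneg[OF p] in \<open>simp add: scaleR_nonneg_nonneg\<close>)
    qed
    then show "l \<le> p m" by (simp only: diff_le_eq add_0)
  qed
qed

lemma order_conv_zero_cesaro:
  assumes "order_conv x 0" "\<And>n. 0 \<le> x n"
  shows "order_conv (cesaro x) 0"
proof -
  obtain p where p: "down_zero p" "\<And>n. rabs (x n) \<le> p n" using assms(1) by (rule order_conv_zeroE) blast
  have le: "x n \<le> p n" for n by (rule order_trans[OF rs.abs_ge_self p(2)])
  show ?thesis
  proof (rule order_conv_zeroI[OF down_zero_cesaro[OF p(1)]])
    show "rabs (cesaro x n) \<le> (if n = 0 then p 0 else cesaro p n)" for n
      using cesaro_mono[of x p n, OF le] cesaro_nonneg[of x n, OF assms(2)] down_zero_nonneg[OF p(1)]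
      by (cases "n = 0") simp_all
  qed
qed

section \<open>Components generate the ideal up to uniform limits\<close>

context unit_ideal
begin

lemma emult_add_left:
  assumes "f \<in> Ee e" "g \<in> Ee e" "h \<in> Ee e"
  shows "emult e (f + t *\<^sub>R g) h = emult e f h + t *\<^sub>R emult e g h"
proof (rule character_eqI)
  show "\<phi> (emult e (f + t *\<^sub>R g) h) = \<phi> (emult e f h + t *\<^sub>R emult e g h)"
    if \<phi>: "character e \<phi>" for \<phi>
    using assms by (simp add: character_simps[OF \<phi>] character_emult[OF \<phi>] algebra_simps)
qed (use assms in simp_all)

lemma emult_commute: "f \<in> Ee e \<Longrightarrow> g \<in> Ee e \<Longrightarrow> emult e f g = emult e g f"
proof (rule character_eqI)
  show "\<phi> (emult e f g) = \<phi> (emult e g f)" if "f \<in> Ee e" "g \<in> Ee e" and \<phi>: "character e \<phi>" for \<phi>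
    using that by (simp add: character_emult[OF \<phi>] mult.commute)
qed simp_all

lemma emult_add_right:
  assumes "f \<in> Ee e" "g \<in> Ee e" "h \<in> Ee e"
  shows "emult e h (f + t *\<^sub>R g) = emult e h f + t *\<^sub>R emult e h g"
  using emult_add_left[OF assms] assms by (simp add: emult_commute[of h])

lemma rabs_le_imp_Ee: "rabs f \<le> c *\<^sub>R e \<Longrightarrow> f \<in> Ee e"
  by (rule Ee_rabs_le[OF Ee_scaleR[OF Ee_unit]])

lemma rabs_emult_le:
  assumes f: "rabs f \<le> a *\<^sub>R e" and g: "rabs g \<le> b *\<^sub>R e"
  shows "rabs (emult e f g) \<le> (a * b) *\<^sub>R e"
proof -
  note fg = rabs_le_imp_Ee[OF f] rabs_le_imp_Ee[OF g]
  show ?thesis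
  proof (rule character_leI)
    fix \<phi> assume \<phi>: "character e \<phi>"
    have "\<bar>\<phi> f\<bar> \<le> a" "\<bar>\<phi> g\<bar> \<le> b"
      using character_mono[OF \<phi> _ _ f] character_mono[OF \<phi> _ _ g] fg
      by (simp_all add: character_simps[OF \<phi>])
    then show "\<phi> (rabs (emult e f g)) \<le> \<phi> ((a * b) *\<^sub>R e)"
      using fg by (simp add: character_simps[OF \<phi>] character_emult[OF \<phi>] abs_mult mult_mono')
  qed (use fg in simp_all)
qed

text \<open>P cuts out the region where f exceeds c / 2. Removing c / 2 there leaves at most c / 2,
  and elsewhere f is at most c / 2 already.\<close>

lemma halving_projection:
  assumes "0 \<le> f" "f \<le> c *\<^sub>R e"
  obtains P where "band_projection P" "0 \<le> f - (c / 2) *\<^sub>R P e" "f - (c / 2) *\<^sub>R P e \<le> (c / 2) *\<^sub>R e"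
proof -
  have f: "f \<in> Ee e" by (rule Ee_le[OF _ assms]) simp
  obtain P where P: "band_projection P" "P (f - (c / 2) *\<^sub>R e) = sup (f - (c / 2) *\<^sub>R e) 0"
    using pos_part_projection .
  note Pe = Ee_band_unit[OF P(1)]
  have \<phi>: "0 \<le> \<phi> (f - (c / 2) *\<^sub>R P e) \<and> \<phi> (f - (c / 2) *\<^sub>R P e) \<le> \<phi> ((c / 2) *\<^sub>R e)"
    if \<phi>: "character e \<phi>" for \<phi>
  proof -
    have "\<phi> (P (f - (c / 2) *\<^sub>R e)) = \<phi> (P e) * \<phi> (f - (c / 2) *\<^sub>R e)" "\<phi> (P e) \<in> {0, 1}"
      using character_band_projection[OF P(1) \<phi>, of "f - (c / 2) *\<^sub>R e"] f by simp_all
    then have "max (\<phi> f - c / 2) 0 = \<phi> (P e) * (\<phi> f - c / 2)" "\<phi> (P e) \<in> {0, 1}"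
      unfolding P(2) using f by (simp_all add: character_simps[OF \<phi>])
    moreover have "0 \<le> \<phi> f" "\<phi> f \<le> c"
      using character_nonneg[OF \<phi> f assms(1)] character_mono[OF \<phi> f _ assms(2)]
      by (simp_all add: character_simps[OF \<phi>])
    ultimately show ?thesis
      using f Pe by (auto simp: character_simps[OF \<phi>] max_def split: if_splits)
  qed
  show ?thesis
  proof (rule that[OF P(1)])
    show "0 \<le> f - (c / 2) *\<^sub>R P e" by (rule character_separates) (use f Pe \<phi> in auto)
    show "f - (c / 2) *\<^sub>R P e \<le> (c / 2) *\<^sub>R e" by (rule character_leI) (use f Pe \<phi> in auto)
  qed
qed

text \<open>This is a binary expansion of f whose digits are components. \<open>F\<close> stands for
  any property closed under adding multiples of components, so finite combinations need no notation;
  the application takes the elements with null means.\<close>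

lemma step_approximation:
  assumes f: "0 \<le> f" "f \<le> c *\<^sub>R e"
    and F: "0 \<in> F" "\<And>g P t. g \<in> F \<Longrightarrow> band_projection P \<Longrightarrow> g + t *\<^sub>R P e \<in> F"
  shows "\<exists>g\<in>F. 0 \<le> f - g \<and> f - g \<le> (c / 2 ^ n) *\<^sub>R e"
proof (induction n)
  case 0
  then show ?case using f F(1) by (intro bexI[of _ 0]) auto
next
  case (Suc n)
  then obtain g where g: "g \<in> F" "0 \<le> f - g" "f - g \<le> (c / 2 ^ n) *\<^sub>R e" by blast
  obtain P where P: "band_projection P" "0 \<le> f - g - (c / 2 ^ n / 2) *\<^sub>R P e"
    "f - g - (c / 2 ^ n / 2) *\<^sub>R P e \<le> (c / 2 ^ n / 2) *\<^sub>R e"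
    using halving_projection[OF g(2,3)] .
  show ?case
  proof (rule bexI[OF _ F(2)[OF g(1) P(1), of "c / 2 ^ n / 2"]])
    show "0 \<le> f - (g + (c / 2 ^ n / 2) *\<^sub>R P e) \<and> f - (g + (c / 2 ^ n / 2) *\<^sub>R P e) \<le> (c / 2 ^ Suc n) *\<^sub>R e"
      using P(2,3) by (simp only: diff_diff_eq[symmetric] power_Suc divide_divide_eq_left mult.commute simp_thms)
  qed
qed

text \<open>\<open>D\<close> stands for the covariance with one argument frozen, so that one lemma
  serves both arguments. The bound with a constant independent of k makes the set of f with null
  means closed under uniform limits.\<close>

lemma cesaro_null_from_components:
  fixes D :: "nat \<Rightarrow> 'a \<Rightarrow> 'a"
  assumes lin: "\<And>k f g t. f \<in> Ee e \<Longrightarrow> g \<in> Ee e \<Longrightarrow> D k (f + t *\<^sub>R g) = D k f + t *\<^sub>R D k g"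
    and bound: "\<And>k f a. rabs f \<le> a *\<^sub>R e \<Longrightarrow> rabs (D k f) \<le> (C * a) *\<^sub>R e"
    and comp: "\<And>P. band_projection P \<Longrightarrow> order_conv (cesaro (\<lambda>k. rabs (D k (P e)))) 0"
    and f: "f \<in> Ee e"
  shows "order_conv (cesaro (\<lambda>k. rabs (D k f))) 0"
proof -
  let ?F = "{f \<in> Ee e. order_conv (cesaro (\<lambda>k. rabs (D k f))) 0}"
  have sum: "order_conv (cesaro (\<lambda>k. rabs (D k (f + t *\<^sub>R g)))) 0"
    if f: "f \<in> Ee e" "order_conv (cesaro (\<lambda>k. rabs (D k f))) 0"
      and g: "g \<in> Ee e" "order_conv (cesaro (\<lambda>k. rabs (D k g))) 0" for f g t
  proof (rule order_conv_zero_mono)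
    show "order_conv (\<lambda>n. cesaro (\<lambda>k. rabs (D k f)) n + \<bar>t\<bar> *\<^sub>R cesaro (\<lambda>k. rabs (D k g)) n) 0"
      by (intro order_conv_zero_add order_conv_zero_scaleR f g)
    fix n
    have "rabs (D k (f + t *\<^sub>R g)) \<le> rabs (D k f) + \<bar>t\<bar> *\<^sub>R rabs (D k g)" for k
      unfolding lin[OF f(1) g(1)] rabs_scaleR[symmetric] by (rule rs.abs_triangle_ineq)
    then have "cesaro (\<lambda>k. rabs (D k (f + t *\<^sub>R g))) n
        \<le> cesaro (\<lambda>k. rabs (D k f) + \<bar>t\<bar> *\<^sub>R rabs (D k g)) n" by (rule cesaro_mono)
    also have "\<dots> = cesaro (\<lambda>k. rabs (D k f)) n + \<bar>t\<bar> *\<^sub>R cesaro (\<lambda>k. rabs (D k g)) n"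
      by (simp only: cesaro_add cesaro_scaleR)
    finally have le: "cesaro (\<lambda>k. rabs (D k (f + t *\<^sub>R g))) n
        \<le> cesaro (\<lambda>k. rabs (D k f)) n + \<bar>t\<bar> *\<^sub>R cesaro (\<lambda>k. rabs (D k g)) n" .
    have nn: "0 \<le> cesaro (\<lambda>k. rabs (D k (f + t *\<^sub>R g))) n" by (rule cesaro_nonneg) simp
    show "rabs (cesaro (\<lambda>k. rabs (D k (f + t *\<^sub>R g))) n)
        \<le> rabs (cesaro (\<lambda>k. rabs (D k f)) n + \<bar>t\<bar> *\<^sub>R cesaro (\<lambda>k. rabs (D k g)) n)"
      by (simp only: rs.abs_of_nonneg[OF nn]) (rule order_trans[OF le rs.abs_ge_self])
  qed
  have D0: "D k 0 = 0" for k using lin[of 0 0 k 1] by simp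
  have z: "0 \<in> ?F"
    using order_conv_zeroI[of "\<lambda>_. 0" "\<lambda>_. 0"] by (simp add: D0 down_zero_def)
  have step: "g + t *\<^sub>R P e \<in> ?F" if "g \<in> ?F" "band_projection P" for g P t
    using that sum comp Ee_band_unit by auto
  have pos: "f \<in> ?F" if f: "f \<in> Ee e" "0 \<le> f" for f
  proof -
    obtain c where c: "0 < c" "f \<le> c *\<^sub>R e" using Ee_bound[OF f(1)] by metis
    have "order_conv (cesaro (\<lambda>k. rabs (D k f))) 0"
    proof (rule order_conv_zero_approx[OF e_nonneg])
      fix \<epsilon> :: real assume \<epsilon>: "0 < \<epsilon>"
      \<comment> \<open>After so many halvings the remainder contributes at most \<epsilon> e; the
        absolute value is there because the sign of C is not prescribed.\<close>
      obtain n where n: "\<bar>C\<bar> * c / \<epsilon> < 2 ^ n" using real_arch_pow[of 2 "\<bar>C\<bar> * c / \<epsilon>"] by auto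
      have "\<exists>g\<in>?F. 0 \<le> f - g \<and> f - g \<le> (c / 2 ^ n) *\<^sub>R e"
        by (rule step_approximation[OF f(2) c(2) z]) (rule step)
      then obtain g where g: "g \<in> ?F" "0 \<le> f - g" "f - g \<le> (c / 2 ^ n) *\<^sub>R e" by blast
      have "C * (c / 2 ^ n) \<le> \<bar>C\<bar> * (c / 2 ^ n)" using c by (intro mult_right_mono) auto
      also have "\<dots> \<le> \<epsilon>" using n \<epsilon> by (simp add: field_simps)
      finally have small: "(C * (c / 2 ^ n)) *\<^sub>R e \<le> \<epsilon> *\<^sub>R e" using e_nonneg by (rule scaleR_right_mono)
      have "rabs (D k f) \<le> rabs (D k g) + \<epsilon> *\<^sub>R e" for k
      proof -
        have "D k f = D k g + 1 *\<^sub>R D k (f - g)"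
          using lin[of g "f - g" k 1] f g(1) by simp
        then have "rabs (D k f) \<le> rabs (D k g) + rabs (D k (f - g))"
          by (simp only: scaleR_one rs.abs_triangle_ineq)
        moreover have "rabs (D k (f - g)) \<le> \<epsilon> *\<^sub>R e"
          using g(2,3) by (intro order_trans[OF bound small]) simp
        ultimately show ?thesis by (meson add_left_mono order_trans)
      qed
      then have 1: "cesaro (\<lambda>k. rabs (D k f)) n \<le> cesaro (\<lambda>k. rabs (D k g) + \<epsilon> *\<^sub>R e) n" for n
        by (rule cesaro_mono)
      have 2: "cesaro (\<lambda>k. \<epsilon> *\<^sub>R e) n \<le> \<epsilon> *\<^sub>R e" for n
        using \<epsilon> e_nonneg by (intro cesaro_le scaleR_nonneg_nonneg) auto
      have "rabs (cesaro (\<lambda>k. rabs (D k f)) n) \<le> cesaro (\<lambda>k. rabs (D k g)) n + \<epsilon> *\<^sub>R e" for n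
      proof -
        have "rabs (cesaro (\<lambda>k. rabs (D k f)) n) = cesaro (\<lambda>k. rabs (D k f)) n"
          by (intro rs.abs_of_nonneg cesaro_nonneg) simp
        also note 1[of n]
        also have "cesaro (\<lambda>k. rabs (D k g) + \<epsilon> *\<^sub>R e) n \<le> cesaro (\<lambda>k. rabs (D k g)) n + \<epsilon> *\<^sub>R e"
          unfolding cesaro_add using 2[of n] by (rule add_left_mono)
        finally show ?thesis .
      qed
      with g(1) show "\<exists>y. order_conv y 0 \<and> (\<forall>n. rabs (cesaro (\<lambda>k. rabs (D k f)) n) \<le> y n + \<epsilon> *\<^sub>R e)"
        by blast
    qed
    with f show ?thesis by simp
  qed
  have p: "sup f 0 \<in> ?F" "sup (- f) 0 \<in> ?F" 
    by (rule pos[OF Ee_sup[OF f Ee_zero] sup_ge2], rule pos[OF Ee_sup[OF Ee_uminus[OF f] Ee_zero] sup_ge2])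
  have eq: "sup f 0 + (-1) *\<^sub>R sup (- f) 0 = f" using sup_zero_diff[of f] by simp
  have "order_conv (cesaro (\<lambda>k. rabs (D k (sup f 0 + (-1) *\<^sub>R sup (- f) 0)))) 0"
    by (rule sum) (use p in auto)
  then show ?thesis unfolding eq .
qed

end

section \<open>Bilinearity and uniform bounds of the covariance\<close>

locale ceps = unit_ideal e for e :: "'a::{ordered_real_vector,conditionally_complete_lattice}" +
  fixes T S :: "'a \<Rightarrow> 'a"
  assumes linear_T: "linear T" and T_nonneg: "0 \<le> x \<Longrightarrow> 0 \<le> T x" and T_unit: "T e = e"
    and linear_S: "linear S" and S_nonneg: "0 \<le> x \<Longrightarrow> 0 \<le> S x" and S_unit: "S e = e"
begin

text \<open>One statement covers \<open>T\<close> and all powers of \<open>S\<close>, with a bound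
  that does not depend on the power.\<close>

lemma markov_bound:
  assumes "linear U" "\<And>x. 0 \<le> x \<Longrightarrow> 0 \<le> U x" "U e = e" "rabs f \<le> a *\<^sub>R e"
  shows "rabs (U f) \<le> a *\<^sub>R e"
proof -
  have "0 \<le> a *\<^sub>R e - f" "0 \<le> a *\<^sub>R e - - f"
    using assms(4) unfolding rabs_le_iff by (simp_all only: diff_ge_0_iff_ge)
  from this[THEN assms(2)] have "0 \<le> a *\<^sub>R e - U f" "0 \<le> a *\<^sub>R e - - U f"
    by (simp_all only: linear_diff[OF assms(1)] linear_cmul[OF assms(1)] linear_neg[OF assms(1)] assms(3))
  then show ?thesis unfolding rabs_le_iff by (simp only: diff_ge_0_iff_ge)
qed

lemma linear_funpow_S: "linear (S ^^ k)"
  by (induction k) (auto intro: linear_compose[unfolded comp_def] linear_S simp: linear_id[unfolded id_def])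

lemma funpow_S_nonneg: "0 \<le> x \<Longrightarrow> 0 \<le> (S ^^ k) x"
  by (induction k) (auto intro: S_nonneg)

lemma funpow_S_unit: "(S ^^ k) e = e"
  by (induction k) (simp_all add: S_unit)

lemmas T_bound = markov_bound[OF linear_T T_nonneg T_unit]
  and S_bound = markov_bound[OF linear_funpow_S funpow_S_nonneg funpow_S_unit]

lemma T_Ee [simp, intro]: "f \<in> Ee e \<Longrightarrow> T f \<in> Ee e"
  using T_bound rabs_le_imp_Ee by (metis Ee_bound)

lemma S_Ee [simp, intro]: "f \<in> Ee e \<Longrightarrow> (S ^^ k) f \<in> Ee e"
  using S_bound rabs_le_imp_Ee by (metis Ee_bound)

definition covar :: "nat \<Rightarrow> 'a \<Rightarrow> 'a \<Rightarrow> 'a" where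
  "covar k f g = T (emult e ((S ^^ k) f) g) - emult e (T f) (T g)"

lemma covar_add_left:
  assumes "f \<in> Ee e" "g \<in> Ee e" "h \<in> Ee e"
  shows "covar k (f + t *\<^sub>R g) h = covar k f h + t *\<^sub>R covar k g h"
  using assms
  by (simp add: covar_def linear_add[OF linear_T] linear_cmul[OF linear_T] linear_add[OF linear_funpow_S]
      linear_cmul[OF linear_funpow_S] emult_add_left scaleR_diff_right)

lemma covar_add_right:
  assumes "f \<in> Ee e" "g \<in> Ee e" "h \<in> Ee e"
  shows "covar k h (f + t *\<^sub>R g) = covar k h f + t *\<^sub>R covar k h g"
  using assms
  by (simp add: covar_def linear_add[OF linear_T] linear_cmul[OF linear_T] emult_add_right scaleR_diff_right)

lemma covar_bound:
  assumes f: "rabs f \<le> a *\<^sub>R e" and g: "rabs g \<le> b *\<^sub>R e"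
  shows "rabs (covar k f g) \<le> (2 * a * b) *\<^sub>R e"
proof -
  have "rabs (covar k f g) \<le> rabs (T (emult e ((S ^^ k) f) g)) + rabs (emult e (T f) (T g))"
    unfolding covar_def by (rule rs.abs_triangle_ineq4)
  also have "\<dots> \<le> (a * b) *\<^sub>R e + (a * b) *\<^sub>R e"
    by (intro add_mono T_bound rabs_emult_le S_bound f g)
  also have "\<dots> = (2 * a * b) *\<^sub>R e" by (simp add: scaleR_add_left[symmetric])
  finally show ?thesis .
qed

text \<open>The arguments are extended one after the other: first f against the components
  \<open>Q e\<close>, then g against the now arbitrary f.\<close>

lemma weak_mixing_extends:
  assumes wm: "\<And>P Q. band_projection P \<Longrightarrow> band_projection Q \<Longrightarrow>
      order_conv (cesaro (\<lambda>k. rabs (covar k (P e) (Q e)))) 0"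
    and f: "f \<in> Ee e" and g: "g \<in> Ee e"
  shows "order_conv (cesaro (\<lambda>k. rabs (covar k f g))) 0"
proof -
  have left: "order_conv (cesaro (\<lambda>k. rabs (covar k f (Q e)))) 0" if Q: "band_projection Q" for Q
  proof -
    note Qe = Ee_band_unit[OF Q]
    obtain b where b: "rabs (Q e) \<le> b *\<^sub>R e" using Ee_bound[OF Qe] by metis
    show ?thesis
    proof (rule cesaro_null_from_components[where C = "2 * b", OF _ _ _ f])
      show "rabs (covar k f (Q e)) \<le> (2 * b * a) *\<^sub>R e" if "rabs f \<le> a *\<^sub>R e" for k f a
        using covar_bound[OF that b, of k] by (simp only: mult.commute mult.left_commute)
    qed (auto intro: covar_add_left wm Q Qe)
  qed
  obtain a where a: "rabs f \<le> a *\<^sub>R e" using Ee_bound[OF f] by metis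
  show ?thesis
  proof (rule cesaro_null_from_components[where C = "2 * a", OF _ _ _ g])
    show "rabs (covar k f g) \<le> (2 * a * b) *\<^sub>R e" if "rabs g \<le> b *\<^sub>R e" for k g b
      using covar_bound[OF a that] .
  qed (auto intro: covar_add_right left f)
qed

end

section \<open>Extending multiplication to the whole space, and density zero\<close>

text \<open>Truncations at multiples of a weak order unit exhaust x. If u is a positive common
  minorant of the remainders, then v = \<open>inf e u\<close> satisfies j v \<le> x for all j, as
  one more v fits into each remainder. So v = 0, \<open>e\<close> lies in the band of elements
  disjoint from u, and this band is the whole space, which makes u disjoint from itself.\<close>

lemma weak_order_unit_lower:
  fixes x l e :: "'a::{ordered_real_vector,conditionally_complete_lattice}"
  assumes e: "weak_order_unit e" and x: "0 \<le> x"
    and l: "\<And>j::nat. l \<le> x - inf x (real j *\<^sub>R e)"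
  shows "l \<le> 0"
proof -
  have e0: "0 \<le> e" and univ: "\<And>B. rs_band B \<Longrightarrow> e \<in> B \<Longrightarrow> B = UNIV"
    using e unfolding weak_order_unit_def by blast+
  define u where "u = sup l 0"
  have u0: "0 \<le> u" by (simp add: u_def)
  have u: "u \<le> x - inf x (real j *\<^sub>R e)" for j
    unfolding u_def by (intro sup_least l) (simp only: diff_ge_0_iff_ge inf_le1)
  define v where "v = inf e u"
  have v: "0 \<le> v" "v \<le> e" "v \<le> u" using e0 u0 by (simp_all add: v_def)
  have "real j *\<^sub>R v \<le> x" for j
  proof (induction j)
    case (Suc j)
    have "real j *\<^sub>R v \<le> real j *\<^sub>R e" using v by (intro scaleR_left_mono) auto
    with Suc have "real j *\<^sub>R v \<le> inf x (real j *\<^sub>R e)" by simp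
    moreover have "v \<le> x - inf x (real j *\<^sub>R e)" using v u order_trans by blast
    ultimately have "real j *\<^sub>R v + v \<le> inf x (real j *\<^sub>R e) + (x - inf x (real j *\<^sub>R e))"
      by (rule add_mono)
    also have "\<dots> = x" by (simp only: add_diff_cancel_left' add_diff_eq)
    finally show ?case by (simp add: scaleR_add_left add.commute)
  qed (use x in simp)
  then have "v \<le> 0" by (rule archimedean_le_zero)
  then have "v = 0" using v(1) by (rule antisym)
  then have "e \<in> disj_compl {u}" using e0 u0 by (simp add: disj_compl_def v_def)
  then have "u \<in> disj_compl {u}" using univ[OF rs_band_disj_compl] by blast
  then have "u = 0" using u0 by (simp add: disj_compl_def)
  moreover have "l \<le> u" by (simp add: u_def)
  ultimately show ?thesis by simp
qed

text \<open>Additivity on the cone makes U a - U b depend only on a - b, so any decomposition into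
  positive elements may be used in place of the positive and negative parts.\<close>

lemma linear_extension_from_cone:
  fixes U :: "'a::{ordered_real_vector,lattice} \<Rightarrow> 'a"
  assumes add: "\<And>x y. 0 \<le> x \<Longrightarrow> 0 \<le> y \<Longrightarrow> U (x + y) = U x + U y"
    and scale: "\<And>c x. 0 < c \<Longrightarrow> 0 \<le> x \<Longrightarrow> U (c *\<^sub>R x) = c *\<^sub>R U x"
  obtains D where "linear D" "\<And>x. 0 \<le> x \<Longrightarrow> D x = U x"
proof -
  define D where "D x = U (sup x 0) - U (sup (- x) 0)" for x
  have U0: "U 0 = 0" using add[of 0 0] by simp
  have D: "D (a - b) = U a - U b" if "0 \<le> a" "0 \<le> b" for a b
  proof -
    have "sup (a - b) 0 + b = a + sup (- (a - b)) 0"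
      using sup_zero_diff[of "a - b"] by (metis add.commute add_diff_eq diff_eq_eq)
    then have "U (sup (a - b) 0) + U b = U a + U (sup (- (a - b)) 0)"
      using that add[of "sup (a - b) 0" b] add[of a "sup (- (a - b)) 0"] by (metis sup_ge2)
    then show ?thesis unfolding D_def by (metis add.commute add_diff_eq diff_eq_eq)
  qed
  have "linear D"
  proof
    fix x y :: 'a
    define a where "a = sup x 0"
    define b where "b = sup (- x) 0"
    define c where "c = sup y 0"
    define d where "d = sup (- y) 0"
    note abcd_def = a_def b_def c_def d_def
    have nn: "0 \<le> a" "0 \<le> b" "0 \<le> c" "0 \<le> d" by (simp_all add: abcd_def)
    have xy: "x = a - b" "y = c - d" unfolding abcd_def by (simp_all only: sup_zero_diff)
    have eq: "x + y = (a + c) - (b + d)" by (simp add: xy)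
    have "D (x + y) = U (a + c) - U (b + d)" unfolding eq using nn by (intro D add_nonneg_nonneg)
    then show "D (x + y) = D x + D y" using nn by (simp add: xy D add)
    fix r :: real
    show "D (r *\<^sub>R x) = r *\<^sub>R D x"
    proof (cases r "0 :: real" rule: linorder_cases)
      case less
      have "r *\<^sub>R x = (- r) *\<^sub>R b - (- r) *\<^sub>R a" by (simp add: xy scaleR_diff_right)
      then show ?thesis using less nn D[of "(- r) *\<^sub>R b" "(- r) *\<^sub>R a"] scale[of "- r" a] scale[of "- r" b]
        by (simp add: xy D scaleR_diff_right scaleR_nonneg_nonneg scaleR_nonpos_nonneg)
    next
      case greater
      have "r *\<^sub>R x = r *\<^sub>R a - r *\<^sub>R b" by (simp add: xy scaleR_diff_right)
      then show ?thesis using greater nn D[of "r *\<^sub>R a" "r *\<^sub>R b"] scale[of r a] scale[of r b]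
        by (simp add: xy D scaleR_diff_right scaleR_nonneg_nonneg)
    qed (simp add: D_def U0)
  qed
  moreover have "D x = U x" if "0 \<le> x" for x using D[OF that, of 0] U0 by simp
  ultimately show ?thesis by (rule that)
qed

section \<open>Multiplication by an element of [0, e], extended to the positive cone\<close>

context unit_ideal
begin

lemma emult_nonneg_mono:
  assumes "c \<in> Ee e" "d \<in> Ee e" "c \<le> d" "y \<in> Ee e" "0 \<le> y"
  shows "emult e c y \<le> emult e d y"
proof (rule character_leI)
  show "\<phi> (emult e c y) \<le> \<phi> (emult e d y)" if \<phi>: "character e \<phi>" for \<phi>
    using assms character_mono[OF \<phi>, of c d] character_nonneg[OF \<phi>, of y]
    by (simp add: character_emult[OF \<phi>] mult_right_mono)
qed (use assms in simp_all)

lemma emult_nonneg: "c \<in> Ee e \<Longrightarrow> y \<in> Ee e \<Longrightarrow> 0 \<le> c \<Longrightarrow> 0 \<le> y \<Longrightarrow> 0 \<le> emult e c y"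
  using falg_mult_emult by (simp add: falg_mult_def)

lemma emult_unit: "f \<in> Ee e \<Longrightarrow> emult e e f = f" "f \<in> Ee e \<Longrightarrow> emult e f e = f"
  using falg_mult_emult by (simp_all add: falg_mult_def)

text \<open>Meaningful only for \<open>x \<ge> 0\<close>, where it extends multiplication by \<open>c\<close> to elements that
  are not \<open>e\<close>-bounded.\<close>

definition ext_mult :: "'a \<Rightarrow> 'a \<Rightarrow> 'a" where
  "ext_mult c x = (SUP y\<in>{y \<in> Ee e. 0 \<le> y \<and> y \<le> x}. emult e c y)"

context
  fixes c assumes c: "0 \<le> c" "c \<le> e"
begin

lemma mult_Ee: "c \<in> Ee e" by (rule Ee_le[OF Ee_unit c])

lemma emult_le_self: "y \<in> Ee e \<Longrightarrow> 0 \<le> y \<Longrightarrow> emult e c y \<le> y"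
  using emult_nonneg_mono[OF mult_Ee Ee_unit c(2)] emult_unit(1) by metis

lemma ext_mult_upper: "y \<in> Ee e \<Longrightarrow> 0 \<le> y \<Longrightarrow> y \<le> x \<Longrightarrow> emult e c y \<le> ext_mult c x"
  unfolding ext_mult_def
  by (rule cSUP_upper) (auto intro!: bdd_aboveI2[of _ _ x] intro: order_trans[OF emult_le_self])

lemma ext_mult_least:
  assumes "0 \<le> x" "\<And>y. y \<in> Ee e \<Longrightarrow> 0 \<le> y \<Longrightarrow> y \<le> x \<Longrightarrow> emult e c y \<le> b"
  shows "ext_mult c x \<le> b"
proof -
  have "0 \<in> {y \<in> Ee e. 0 \<le> y \<and> y \<le> x}" using assms by simp
  then show ?thesis unfolding ext_mult_def using assms(2) by (intro cSUP_least) auto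
qed

lemma ext_mult_nonneg: "0 \<le> x \<Longrightarrow> 0 \<le> ext_mult c x"
  using ext_mult_upper[of 0 x] emult_nonneg[OF mult_Ee Ee_zero c(1)] order_trans by blast

text \<open>For \<le>, Riesz decomposition splits an e-bounded z below x + y into
  \<open>inf z x\<close> and a rest below y. For the converse the suprema over a and over b are
  taken one at a time.\<close>

lemma ext_mult_add:
  assumes x: "0 \<le> x" and y: "0 \<le> y"
  shows "ext_mult c (x + y) = ext_mult c x + ext_mult c y"
proof (rule antisym)
  show "ext_mult c (x + y) \<le> ext_mult c x + ext_mult c y"
  proof (rule ext_mult_least)
    fix z assume z: "z \<in> Ee e" "0 \<le> z" "z \<le> x + y"
    define a where "a = inf z x"
    have a: "0 \<le> a" "a \<le> z" "a \<le> x" using z x by (simp_all add: a_def)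
    have aE: "a \<in> Ee e" by (rule Ee_le[OF z(1) a(1,2)])
    have "z - y \<le> a" using z y by (simp add: a_def diff_le_eq add_increasing2)
    then have b: "z - a \<le> y" by (simp only: diff_le_eq add.commute)
    have "emult e c (a + 1 *\<^sub>R (z - a)) = emult e c a + 1 *\<^sub>R emult e c (z - a)"
      using aE z by (intro emult_add_right mult_Ee) auto
    then have "emult e c z = emult e c a + emult e c (z - a)" by simp
    also have "\<dots> \<le> ext_mult c x + ext_mult c y"
      using a aE b z by (intro add_mono ext_mult_upper) auto
    finally show "emult e c z \<le> ext_mult c x + ext_mult c y" .
  qed (use x y in simp)
  have "ext_mult c x \<le> ext_mult c (x + y) - ext_mult c y"
  proof (rule ext_mult_least[OF x])
    fix a assume a: "a \<in> Ee e" "0 \<le> a" "a \<le> x"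
    have "ext_mult c y \<le> ext_mult c (x + y) - emult e c a"
    proof (rule ext_mult_least[OF y])
      fix b assume b: "b \<in> Ee e" "0 \<le> b" "b \<le> y"
      have "emult e c (b + 1 *\<^sub>R a) = emult e c b + 1 *\<^sub>R emult e c a"
        using a b by (intro emult_add_right mult_Ee) auto
      moreover have "emult e c (b + 1 *\<^sub>R a) \<le> ext_mult c (x + y)"
        using a b by (intro ext_mult_upper) (auto simp: add.commute intro: add_mono)
      ultimately show "emult e c b \<le> ext_mult c (x + y) - emult e c a" by (simp add: le_diff_eq)
    qed
    then show "emult e c a \<le> ext_mult c (x + y) - ext_mult c y" by (simp only: le_diff_eq add.commute)
  qed
  then show "ext_mult c x + ext_mult c y \<le> ext_mult c (x + y)" by (simp only: le_diff_eq)
qed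

text \<open>One inequality suffices: applied with \<open>inverse t\<close> it gives the
  other.\<close>

lemma ext_mult_scaleR:
  assumes t: "0 < t" and x: "0 \<le> x"
  shows "ext_mult c (t *\<^sub>R x) = t *\<^sub>R ext_mult c x"
proof -
  have half: "ext_mult c (t *\<^sub>R x) \<le> t *\<^sub>R ext_mult c x" if t: "0 < t" and x: "0 \<le> x" for t x
  proof (rule ext_mult_least)
    fix y assume y: "y \<in> Ee e" "0 \<le> y" "y \<le> t *\<^sub>R x"
    have "inverse t *\<^sub>R y \<le> x" using scaleR_left_mono[OF y(3), of "inverse t"] t by simp
    then have "emult e c (inverse t *\<^sub>R y) \<le> ext_mult c x"
      using y t by (intro ext_mult_upper) (auto intro: scaleR_nonneg_nonneg)
    moreover have "emult e c (0 + inverse t *\<^sub>R y) = emult e c 0 + inverse t *\<^sub>R emult e c y"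
      using y by (intro emult_add_right mult_Ee) auto
    \<comment> \<open>This instance of additivity yields that the product with 0 is 0.\<close>
    moreover have "emult e c (0 + 1 *\<^sub>R 0) = emult e c 0 + 1 *\<^sub>R emult e c 0"
      by (intro emult_add_right mult_Ee) auto
    ultimately have "inverse t *\<^sub>R emult e c y \<le> ext_mult c x" by simp
    from scaleR_left_mono[OF this, of t] t show "emult e c y \<le> t *\<^sub>R ext_mult c x" by simp
  qed (use t x in \<open>simp add: scaleR_nonneg_nonneg\<close>)
  have "ext_mult c (inverse t *\<^sub>R (t *\<^sub>R x)) \<le> inverse t *\<^sub>R ext_mult c (t *\<^sub>R x)"
    using t x by (intro half scaleR_nonneg_nonneg) auto
  then have "ext_mult c x \<le> inverse t *\<^sub>R ext_mult c (t *\<^sub>R x)" using t by simp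
  from scaleR_left_mono[OF this, of t] t have "t *\<^sub>R ext_mult c x \<le> ext_mult c (t *\<^sub>R x)" by simp
  with half[OF t x] show ?thesis by (rule antisym)
qed

text \<open>Multiplication by c gives at most j c on what lies below j e and does not enlarge the
  rest. The first term is linear in c and the second is free of c, so along multipliers decreasing
  to 0 only the truncation error at j survives, for every j.\<close>

lemma ext_mult_truncate:
  assumes x: "0 \<le> x"
  shows "ext_mult c x \<le> real j *\<^sub>R c + (x - inf x (real j *\<^sub>R e))"
proof (rule ext_mult_least[OF x])
  fix y assume y: "y \<in> Ee e" "0 \<le> y" "y \<le> x"
  define w where "w = inf x (real j *\<^sub>R e)"
  have w: "0 \<le> w" "w \<le> x" "w \<le> real j *\<^sub>R e"
    using x e_nonneg by (simp_all add: w_def scaleR_nonneg_nonneg)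
  have wE: "w \<in> Ee e" by (rule Ee_le[OF _ w(1,3)]) simp
  have iE: "inf y w \<in> Ee e" using y wE by simp
  have dE: "y - inf y w \<in> Ee e" by (rule Ee_diff[OF y(1) iE])
  have "emult e c (inf y w + 1 *\<^sub>R (y - inf y w)) = emult e c (inf y w) + 1 *\<^sub>R emult e c (y - inf y w)"
    by (rule emult_add_right[OF iE dE mult_Ee])
  then have "emult e c y = emult e c (inf y w) + emult e c (y - inf y w)"
    by (simp only: scaleR_one add_diff_cancel_left' add_diff_eq)
  also have "emult e c (y - inf y w) \<le> y - inf y w"
    by (rule emult_le_self[OF dE]) (simp only: diff_ge_0_iff_ge inf_le1)
  also have "y - inf y w \<le> x - w"
  proof -
    have "y - (x - w) \<le> inf y w"
    proof (rule le_infI)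
      show "y - (x - w) \<le> y" using w(2) by (simp add: diff_le_eq add_increasing2)
      have "y + w \<le> w + x" using y(3) by (simp add: add.commute)
      then show "y - (x - w) \<le> w" by (simp add: diff_le_eq add.commute)
    qed
    then show ?thesis by (simp only: diff_le_eq add.commute)
  qed
  also have "emult e c (inf y w) \<le> real j *\<^sub>R c"
  proof (rule character_leI)
    fix \<phi> assume \<phi>: "character e \<phi>"
    have "\<phi> (inf y w) \<le> \<phi> (real j *\<^sub>R e)" using w iE by (intro character_mono[OF \<phi>]) (auto intro: le_infI2)
    then have "\<phi> (inf y w) \<le> real j" by (simp add: character_scaleR[OF \<phi> Ee_unit] character_unit[OF \<phi>])
    then have "\<phi> c * \<phi> (inf y w) \<le> \<phi> c * real j"
      by (rule mult_left_mono) (rule character_nonneg[OF \<phi> mult_Ee c(1)])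
    then show "\<phi> (emult e c (inf y w)) \<le> \<phi> (real j *\<^sub>R c)"
      by (simp only: character_emult[OF \<phi> mult_Ee iE] character_scaleR[OF \<phi> mult_Ee] mult.commute)
  qed (use mult_Ee iE in auto)
  finally show "emult e c y \<le> real j *\<^sub>R c + (x - inf x (real j *\<^sub>R e))" by (simp add: w_def)
qed

end

section \<open>Means under characters and a criterion for density zero\<close>

lemma Ee_sum: "(\<And>k::nat. x k \<in> Ee e) \<Longrightarrow> (\<Sum>k<n. x k) \<in> Ee e"
  by (induction n) simp_all

lemma character_sum:
  assumes \<phi>: "character e \<phi>" and x: "\<And>k::nat. x k \<in> Ee e"
  shows "\<phi> (\<Sum>k<n. x k) = (\<Sum>k<n. \<phi> (x k))"
proof (induction n)
  case (Suc n)
  then show ?case by (simp add: character_add[OF \<phi> Ee_sum x] x)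
qed (simp add: character_zero[OF \<phi>])

lemma Ee_cesaro: "(\<And>k. x k \<in> Ee e) \<Longrightarrow> cesaro x n \<in> Ee e"
  by (intro Ee_scaleR Ee_sum)

lemma character_cesaro:
  assumes \<phi>: "character e \<phi>" and x: "\<And>k. x k \<in> Ee e"
  shows "\<phi> (cesaro x n) = (1 / real n) * (\<Sum>k<n. \<phi> (x k))"
  by (simp only: character_scaleR[OF \<phi> Ee_sum[OF x]] character_sum[OF \<phi> x])

text \<open>On \<open>Ee e\<close> the mean of the projections is multiplication by the mean of the
  \<open>R k e\<close>. Capping b n at \<open>e\<close> loses nothing, as these means are at most
  \<open>e\<close>, and brings the multiplier into the range for which \<open>ext_mult\<close> is
  developed.\<close>

lemma density_zeroI:
  assumes wu: "weak_order_unit e" and R: "\<And>n. band_projection (R n)"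
    and b: "down_zero b" "\<And>n. cesaro (\<lambda>k. R k e) n \<le> b n"
  shows "density_zero R"
proof -
  define c where "c n = inf (b n) e" for n
  have c: "0 \<le> c n" "c n \<le> e" for n using down_zero_nonneg[OF b(1)] e_nonneg by (simp_all add: c_def)
  have cb: "c n \<le> b n" for n by (simp add: c_def)
  have cE: "c n \<in> Ee e" for n by (rule mult_Ee[OF c])
  have cdec: "c (Suc n) \<le> c n" for n
    unfolding c_def by (intro inf_mono down_zero_le[OF b(1)]) auto
  have "\<exists>D. linear D \<and> (\<forall>x. 0 \<le> x \<longrightarrow> D x = ext_mult (c n) x)" for n
    using linear_extension_from_cone[of "ext_mult (c n)"] ext_mult_add[OF c] ext_mult_scaleR[OF c] by metis
  then obtain D where D: "\<And>n. linear (D n)" "\<And>n x. 0 \<le> x \<Longrightarrow> D n x = ext_mult (c n) x" by metis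
  have ReE: "R k e \<in> Ee e" for k by (rule Ee_band_unit[OF R])
  have dle: "cesaro (\<lambda>k. R k e) n \<le> c n" for n
    unfolding c_def using b(2) by (auto intro!: cesaro_le band_projection_le[OF R] e_nonneg)
  have mult: "cesaro (\<lambda>k. R k y) n \<le> ext_mult (c n) x" if y: "y \<in> Ee e" "0 \<le> y" "y \<le> x" for n x y
  proof -
    have "cesaro (\<lambda>k. R k y) n = emult e (cesaro (\<lambda>k. R k e) n) y"
    proof (rule character_eqI)
      fix \<phi> assume \<phi>: "character e \<phi>"
      have "(\<Sum>k<n. \<phi> (R k y)) = (\<Sum>k<n. \<phi> (R k e)) * \<phi> y"
        unfolding sum_distrib_right by (rule sum.cong) (simp_all add: character_band_projection(2)[OF R \<phi> y(1)])
      then show "\<phi> (cesaro (\<lambda>k. R k y) n) = \<phi> (emult e (cesaro (\<lambda>k. R k e) n) y)"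
        by (simp only: character_emult[OF \<phi> Ee_cesaro[OF ReE] y(1)] character_cesaro[OF \<phi> ReE]
            character_cesaro[OF \<phi> Ee_band_image[OF R y(1)]] mult.assoc)
    qed (intro emult_in_Ee Ee_cesaro ReE Ee_band_image[OF R] y)+
    also have "\<dots> \<le> emult e (c n) y" by (intro emult_nonneg_mono Ee_cesaro ReE cE dle y)
    also have "\<dots> \<le> ext_mult (c n) x" by (intro ext_mult_upper c y)
    finally show ?thesis .
  qed
  show ?thesis
    unfolding density_zero_def
  proof (intro exI[of _ D] conjI allI impI)
    show "linear (D n)" for n by (rule D)
    fix x :: 'a assume x: "0 \<le> x"
    show "D (Suc n) x \<le> D n x" for n
      unfolding D(2)[OF x]
    proof (rule ext_mult_least[OF c x])
      fix y assume y: "y \<in> Ee e" "0 \<le> y" "y \<le> x"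
      have "emult e (c (Suc n)) y \<le> emult e (c n) y" by (intro emult_nonneg_mono cE cdec y)
      also have "\<dots> \<le> ext_mult (c n) x" by (intro ext_mult_upper c y)
      finally show "emult e (c (Suc n)) y \<le> ext_mult (c n) x" .
    qed
    show "cesaro (\<lambda>k. R k x) n \<le> D n x" for n
    proof -
      \<comment> \<open>The truncation w obeys the bound already; on x - w the mean is at most x -
        w, and \<open>weak_order_unit_lower\<close> disposes of this error.\<close>
      have "cesaro (\<lambda>k. R k x) n - ext_mult (c n) x \<le> 0"
      proof (rule weak_order_unit_lower[OF wu x])
        fix j
        define w where "w = inf x (real j *\<^sub>R e)"
        have w: "0 \<le> w" "w \<le> x" "w \<le> real j *\<^sub>R e"
          using x e_nonneg by (simp_all add: w_def scaleR_nonneg_nonneg)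
        have wE: "w \<in> Ee e" by (rule Ee_le[OF _ w(1,3)]) simp
        have "R k x = R k w + R k (x - w)" for k
          by (simp add: linear_diff[OF band_projection_linear[OF R]])
        then have "cesaro (\<lambda>k. R k x) n = cesaro (\<lambda>k. R k w) n + cesaro (\<lambda>k. R k (x - w)) n"
          by (simp only: cesaro_add)
        also have "\<dots> \<le> ext_mult (c n) x + (x - w)"
          using w by (intro add_mono mult wE cesaro_le band_projection_le[OF R]) auto
        finally show "cesaro (\<lambda>k. R k x) n - ext_mult (c n) x \<le> x - inf x (real j *\<^sub>R e)"
          by (simp only: diff_le_eq w_def add.commute)
      qed
      then show ?thesis unfolding D(2)[OF x] by (simp only: diff_le_eq add_0)
    qed
    have nn: "0 \<le> D n x" for n unfolding D(2)[OF x] by (rule ext_mult_nonneg[OF c x])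
    show "(INF n. D n x) = 0"
    proof (rule antisym)
      show "0 \<le> (INF n. D n x)" using nn by (intro cINF_greatest) auto
      \<comment> \<open>Two separate limits: for fixed j, letting n grow leaves the truncation error
        at j, which then disappears as j varies.\<close>
      show "(INF n. D n x) \<le> 0"
      proof (rule weak_order_unit_lower[OF wu x])
        fix j
        let ?w = "x - inf x (real j *\<^sub>R e)"
        have "(INF n. D n x) - ?w \<le> 0"
        proof (rule down_zero_lower[OF down_zero_scaleR[OF b(1), of "real j"]])
          fix n
          have "(INF n. D n x) \<le> D n x" using nn by (intro cINF_lower bdd_belowI2[of _ 0]) auto
          also have "\<dots> \<le> real j *\<^sub>R c n + ?w" unfolding D(2)[OF x] by (rule ext_mult_truncate[OF c x])
          also have "\<dots> \<le> real j *\<^sub>R b n + ?w" by (intro add_right_mono scaleR_left_mono cb) simp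
          finally show "(INF n. D n x) - ?w \<le> real j *\<^sub>R b n" by (simp only: diff_le_eq)
        qed simp
        then show "(INF n. D n x) \<le> ?w" by (simp only: diff_le_eq add_0)
      qed
    qed
  qed
qed

text \<open>By the inequality of arithmetic and geometric means, the root of \<open>q\<close> is the infimum over
  \<open>a > 0\<close> of \<open>q / (2 a) + a / 2\<close>.\<close>

lemma sqrt_exists:
  assumes q: "q \<in> Ee e" and \<epsilon>: "0 < \<epsilon>" "\<epsilon> *\<^sub>R e \<le> q"
  shows "\<exists>b. b \<in> Ee e \<and> (\<forall>\<phi>. character e \<phi> \<longrightarrow> \<phi> b = sqrt (\<phi> q))"
proof -
  obtain k0 where k0: "0 < k0" "q \<le> k0 *\<^sub>R e" using Ee_bound[OF q] by metis
  define k where "k = max k0 \<epsilon>"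
  have "k0 *\<^sub>R e \<le> k *\<^sub>R e" using e_nonneg by (intro scaleR_right_mono) (auto simp: k_def)
  with k0 have k: "q \<le> k *\<^sub>R e" "\<epsilon> \<le> k" by (auto simp: k_def intro: order_trans)
  \<comment> \<open>The interval contains every value sqrt (\<phi> q); its positive left end bounds
    the slopes 1 / (2 a) of the functions \<open>F\<close>, which are affine in q.\<close>
  define A where "A = {sqrt \<epsilon>..sqrt k}"
  have Apos: "0 < a" if "a \<in> A" for a using that \<epsilon> by (auto simp: A_def intro: less_le_trans[of 0 "sqrt \<epsilon>"])
  have A0: "sqrt \<epsilon> \<in> A" using k by (simp add: A_def)
  define F where "F a = (1 / (2 * a)) *\<^sub>R q + (a / 2) *\<^sub>R e" for a
  define b where "b = (INF a\<in>A. F a)"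
  have FE: "F a \<in> Ee e" for a using q by (simp add: F_def)
  have q0: "0 \<le> q" using \<epsilon> e_nonneg by (meson less_imp_le order_trans scaleR_nonneg_nonneg)
  have Fnn: "0 \<le> F a" if "a \<in> A" for a
    using Apos[OF that] q0 e_nonneg by (simp add: F_def scaleR_nonneg_nonneg)
  have bdd: "bdd_below (F ` A)" by (rule bdd_belowI2[OF Fnn])
  have low: "b \<le> F a" if "a \<in> A" for a unfolding b_def using bdd that by (rule cINF_lower)
  have b0: "0 \<le> b" unfolding b_def using A0 Fnn by (intro cINF_greatest) auto
  have bE: "b \<in> Ee e" by (rule Ee_le[OF FE b0 low[OF A0]])
  have \<phi>F: "\<phi> (F a) = \<phi> q / (2 * a) + a / 2" if "character e \<phi>" for \<phi> a
    using q by (simp add: F_def character_simps[OF that])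
  have amgm: "sqrt t \<le> t / (2 * a) + a / 2" if "0 < a" "0 \<le> t" for t a :: real
  proof -
    have "2 * sqrt t * a \<le> t + a * a"
      using zero_le_power2[of "sqrt t - a"] that by (simp add: power2_eq_square algebra_simps)
    then show ?thesis using that by (simp add: field_simps)
  qed
  have "\<phi> b = sqrt (\<phi> q)" if \<phi>: "character e \<phi>" for \<phi>
  proof -
    define t where "t = \<phi> q"
    have t: "\<epsilon> \<le> t" "t \<le> k"
      using character_mono[OF \<phi> _ q \<epsilon>(2)] character_mono[OF \<phi> q _ k(1)]
      by (simp_all add: t_def character_simps[OF \<phi>])
    then have tA: "sqrt t \<in> A" by (simp add: A_def)
    \<comment> \<open>A common minorant of all \<open>F a\<close> whose value under \<phi> is sqrt
      t, needed because characters need not commute with the infimum. The coefficient of |q - t e|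
      is the largest slope that occurs.\<close>
    define u where "u = sqrt t *\<^sub>R e - (1 / (2 * sqrt \<epsilon>)) *\<^sub>R rabs (q - t *\<^sub>R e)"
    have uE: "u \<in> Ee e" using q by (simp add: u_def)
    have "u \<le> F a" if a: "a \<in> A" for a
    proof (rule character_leI[OF uE FE])
      fix \<psi> assume \<psi>: "character e \<psi>"
      have "- (\<psi> q - t) / (2 * a) \<le> \<bar>\<psi> q - t\<bar> / (2 * a)"
        using Apos[OF a] by (intro divide_right_mono) auto
      also have "\<dots> \<le> \<bar>\<psi> q - t\<bar> / (2 * sqrt \<epsilon>)"
        using a \<epsilon> Apos[OF a] by (intro divide_left_mono) (auto simp: A_def)
      finally have "- (\<psi> q - t) / (2 * a) \<le> \<bar>\<psi> q - t\<bar> / (2 * sqrt \<epsilon>)" .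
      moreover have "sqrt t \<le> t / (2 * a) + a / 2" using Apos[OF a] t \<epsilon> by (intro amgm) auto
      moreover have "\<psi> q / (2 * a) = t / (2 * a) - - (\<psi> q - t) / (2 * a)"
        by (simp add: diff_divide_distrib)
      ultimately have "sqrt t - \<bar>\<psi> q - t\<bar> / (2 * sqrt \<epsilon>) \<le> \<psi> q / (2 * a) + a / 2" by linarith
      then show "\<psi> u \<le> \<psi> (F a)" using q by (simp add: u_def \<phi>F[OF \<psi>] character_simps[OF \<psi>])
    qed
    then have "u \<le> b" unfolding b_def using A0 by (intro cINF_greatest) auto
    then have "sqrt t \<le> \<phi> b"
      using character_mono[OF \<phi> uE bE] q by (simp add: u_def t_def character_simps[OF \<phi>])
    moreover have "t / (2 * sqrt t) = sqrt t / 2"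
      using t \<epsilon> by (simp add: real_div_sqrt flip: divide_divide_eq_left')
    with character_mono[OF \<phi> bE FE low[OF tA]] have "\<phi> b \<le> sqrt t"
      by (simp add: \<phi>F[OF \<phi>] t_def[symmetric])
    ultimately show ?thesis by (simp add: t_def)
  qed
  with bE show ?thesis by blast
qed

end

section \<open>The Koopman--von Neumann lemma\<close>

context unit_ideal
begin

lemma cesaro_null_imp_density_null:
  fixes a :: "nat \<Rightarrow> 'a"
  assumes wu: "weak_order_unit e"
    and a: "\<And>k. 0 \<le> a k" "\<And>k. a k \<le> C *\<^sub>R e" and C: "0 \<le> C"
    and null: "order_conv (cesaro a) 0"
  shows "\<exists>R. (\<forall>n. band_projection (R n)) \<and> density_zero R \<and> order_conv (\<lambda>n. a n - R n (a n)) 0"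
proof -
  have aE: "a k \<in> Ee e" for k by (rule Ee_le[OF _ a]) simp
  obtain p where p: "down_zero p" "\<And>n. rabs (cesaro a n) \<le> p n" using null by (rule order_conv_zeroE) blast
  have Ce: "0 \<le> C *\<^sub>R e" using C e_nonneg by (rule scaleR_nonneg_nonneg)
  \<comment> \<open>p n need not be e-bounded, as square roots and characters require; the means of
    a lie below C e, so the cap costs nothing.\<close>
  define p' where "p' n = inf (p n) (C *\<^sub>R e)" for n
  have "down_zero p'"
  proof (rule down_zeroI)
    show "p' (Suc n) \<le> p' n" for n unfolding p'_def by (intro inf_mono down_zero_le[OF p(1)]) auto
    show "0 \<le> p' n" for n unfolding p'_def by (intro le_infI down_zero_nonneg[OF p(1)] Ce)
    show "l \<le> 0" if "\<And>n. l \<le> p' n" for l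
      using that by (intro down_zero_lower[OF p(1)]) (auto simp: p'_def)
  qed
  moreover have "down_zero (\<lambda>n. (1 / real (Suc n)) *\<^sub>R e)"
  proof (rule down_zeroI)
    show "(1 / real (Suc (Suc n))) *\<^sub>R e \<le> (1 / real (Suc n)) *\<^sub>R e" for n
      using e_nonneg by (intro scaleR_right_mono) (auto simp: field_simps)
    show "0 \<le> (1 / real (Suc n)) *\<^sub>R e" for n using e_nonneg by (intro scaleR_nonneg_nonneg) auto
    fix l assume l: "\<And>n. l \<le> (1 / real (Suc n)) *\<^sub>R e"
    show "l \<le> 0"
    proof (rule archimedean_le_zero)
      fix n
      show "real n *\<^sub>R l \<le> e"
      proof (cases n)
        case (Suc m)
        with scaleR_left_mono[OF l[of m], of "real n"] show ?thesis by simp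
      qed (use e_nonneg in simp)
    qed
  qed
  ultimately have q: "down_zero (\<lambda>n. p' n + (1 / real (Suc n)) *\<^sub>R e)" by (rule down_zero_add)
  \<comment> \<open>The second summand makes every character strictly positive on \<open>q n\<close>, hence on its root.\<close>
  define q where "q n = p' n + (1 / real (Suc n)) *\<^sub>R e" for n
  have q_down: "down_zero q" using q by (simp only: q_def[abs_def])
  have p'0: "0 \<le> p' n" for n unfolding p'_def by (intro le_infI down_zero_nonneg[OF p(1)] Ce)
  have qE: "q n \<in> Ee e" for n
    unfolding q_def using p'0 by (intro Ee_add Ee_le[of "C *\<^sub>R e" "p' n"]) (auto simp: p'_def)
  have qlow: "(1 / real (Suc n)) *\<^sub>R e \<le> q n" for n unfolding q_def using p'0 by (rule add_increasing) simp
  have aq: "cesaro a n \<le> q n" for n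
  proof -
    have "cesaro a n \<le> p' n"
      unfolding p'_def
      by (rule le_infI[OF order_trans[OF rs.abs_ge_self p(2)] cesaro_le[OF a(2) Ce]])
    also have "\<dots> \<le> q n" unfolding q_def using e_nonneg by (simp add: scaleR_nonneg_nonneg)
    finally show ?thesis .
  qed
  define b where "b n = (SOME b. b \<in> Ee e \<and> (\<forall>\<phi>. character e \<phi> \<longrightarrow> \<phi> b = sqrt (\<phi> (q n))))" for n
  have "b n \<in> Ee e \<and> (\<forall>\<phi>. character e \<phi> \<longrightarrow> \<phi> (b n) = sqrt (\<phi> (q n)))" for n
    unfolding b_def by (rule someI_ex[OF sqrt_exists[OF qE _ qlow]]) simp
  then have bE: "b n \<in> Ee e" and b: "character e \<phi> \<Longrightarrow> \<phi> (b n) = sqrt (\<phi> (q n))" for n \<phi> by blast+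
  have \<phi>q: "0 < \<phi> (q n)" if \<phi>: "character e \<phi>" for \<phi> n
  proof -
    have "1 / real (Suc n) \<le> \<phi> (q n)"
      using character_mono[OF \<phi> Ee_scaleR[OF Ee_unit] qE qlow[of n]]
      by (simp only: character_scaleR[OF \<phi> Ee_unit] character_unit[OF \<phi>] mult_1_right)
    then show ?thesis by (rule less_le_trans[rotated]) simp
  qed
  have b_mono: "b n \<le> b k" if "k \<le> n" for k n
  proof (rule character_leI[OF bE bE])
    show "\<phi> (b n) \<le> \<phi> (b k)" if \<phi>: "character e \<phi>" for \<phi>
      unfolding b[OF \<phi>] using character_mono[OF \<phi> qE qE down_zero_le[OF q_down \<open>k \<le> n\<close>]] by simp
  qed
  have b_nonneg: "0 \<le> b n" for n
  proof (rule character_separates[OF bE])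
    show "0 \<le> \<phi> (b n)" if \<phi>: "character e \<phi>" for \<phi>
      unfolding b[OF \<phi>] using \<phi>q[OF \<phi>, of n] by simp
  qed
  have b_down: "down_zero b"
  proof (rule down_zeroI)
    show "b (Suc n) \<le> b n" for n by (rule b_mono) simp
    show "0 \<le> b n" for n by (rule b_nonneg)
    fix l assume l: "\<And>n. l \<le> b n"
    show "l \<le> 0"
    proof (rule archimedean_le[OF e_nonneg])
      fix \<epsilon> :: real assume \<epsilon>: "0 < \<epsilon>"
      \<comment> \<open>The root is not linear, but by the arithmetic-geometric mean inequality it
        lies below affine functions of q n. As q decreases to 0, a lower bound of all b n is then at
        most \<epsilon> e.\<close>
      have bq: "b n \<le> (1 / (4 * \<epsilon>)) *\<^sub>R q n + \<epsilon> *\<^sub>R e" for n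
      proof (rule character_leI[OF bE])
        fix \<phi> assume \<phi>: "character e \<phi>"
        have "4 * \<epsilon> * sqrt (\<phi> (q n)) \<le> \<phi> (q n) + 4 * \<epsilon> * \<epsilon>"
          using zero_le_power2[of "sqrt (\<phi> (q n)) - 2 * \<epsilon>"] \<phi>q[OF \<phi>, of n]
          by (simp add: power2_eq_square algebra_simps)
        then have "sqrt (\<phi> (q n)) \<le> (1 / (4 * \<epsilon>)) * \<phi> (q n) + \<epsilon>"
          using \<epsilon> by (simp add: field_simps)
        then show "\<phi> (b n) \<le> \<phi> ((1 / (4 * \<epsilon>)) *\<^sub>R q n + \<epsilon> *\<^sub>R e)"
          using qE by (simp add: b[OF \<phi>] character_add[OF \<phi>] character_scaleR[OF \<phi>] character_unit[OF \<phi>])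
      qed (use qE in simp)
      have "l - \<epsilon> *\<^sub>R e \<le> 0"
      proof (rule down_zero_lower[OF down_zero_scaleR[OF q_down, of "1 / (4 * \<epsilon>)"]])
        show "l - \<epsilon> *\<^sub>R e \<le> (1 / (4 * \<epsilon>)) *\<^sub>R q n" for n
          unfolding diff_le_eq by (rule order_trans[OF l bq])
      qed (use \<epsilon> in simp)
      then show "l \<le> 0 + \<epsilon> *\<^sub>R e" by (simp only: diff_le_eq)
    qed
  qed
  have "\<exists>P. band_projection P \<and> P (a n - b n) = sup (a n - b n) 0" for n
    using pos_part_projection[of "a n - b n"] by metis
  then obtain R where R: "\<And>n. band_projection (R n)" "\<And>n. R n (a n - b n) = sup (a n - b n) 0" by metis
  note ReE = Ee_band_unit[OF R(1)]
  \<comment> \<open>Under a character R n is the indicator of a n exceeding b n; in the case of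
    equality either value may occur.\<close>
  have dich: "\<phi> (R n e) = 0 \<and> \<phi> (a n) \<le> \<phi> (b n) \<or> \<phi> (R n e) = 1 \<and> \<phi> (b n) \<le> \<phi> (a n)"
    if \<phi>: "character e \<phi>" for \<phi> n
  proof -
    have "\<phi> (sup (a n - b n) 0) = \<phi> (R n e) * \<phi> (a n - b n)" "\<phi> (R n e) \<in> {0, 1}"
      using character_band_projection[OF R(1)[of n] \<phi>, of "a n - b n"] aE bE by (simp_all add: R(2))
    then have "max (\<phi> (a n) - \<phi> (b n)) 0 = \<phi> (R n e) * (\<phi> (a n) - \<phi> (b n))" "\<phi> (R n e) \<in> {0, 1}"
      using aE bE by (simp_all add: character_simps[OF \<phi>])
    then show ?thesis by (auto simp: max_def split: if_splits)
  qed
  have "density_zero R"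
  proof (rule density_zeroI[OF wu R(1) b_down])
    fix n
    show "cesaro (\<lambda>k. R k e) n \<le> b n"
    proof (rule character_leI[OF Ee_cesaro[OF ReE] bE])
      fix \<phi> assume \<phi>: "character e \<phi>"
      \<comment> \<open>A Chebyshev estimate under \<phi>: if R k e has value 1, then b n \<le> b k
        \<le> a k; otherwise the left side is 0.\<close>
      have "\<phi> (R k e) * \<phi> (b n) \<le> \<phi> (a k)" if "k < n" for k
      proof -
        have "\<phi> (b n) \<le> \<phi> (b k)" using that by (intro character_mono[OF \<phi> bE bE] b_mono) simp
        moreover have "0 \<le> \<phi> (a k)" by (rule character_nonneg[OF \<phi> aE a(1)])
        ultimately show ?thesis using dich[OF \<phi>, of k] by auto
      qed
      then have "(\<Sum>k<n. \<phi> (R k e)) * \<phi> (b n) \<le> (\<Sum>k<n. \<phi> (a k))"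
        unfolding sum_distrib_right by (intro sum_mono) simp
      then have "(1 / real n) * ((\<Sum>k<n. \<phi> (R k e)) * \<phi> (b n)) \<le> (1 / real n) * (\<Sum>k<n. \<phi> (a k))"
        by (rule mult_left_mono) simp
      then have "\<phi> (cesaro (\<lambda>k. R k e) n) * \<phi> (b n) \<le> \<phi> (cesaro a n)"
        by (simp only: character_cesaro[OF \<phi> ReE] character_cesaro[OF \<phi> aE] mult.assoc)
      also have "\<dots> \<le> \<phi> (q n)" by (rule character_mono[OF \<phi> Ee_cesaro[OF aE] qE aq])
      also have "\<dots> = \<phi> (b n) * \<phi> (b n)" using \<phi>q[OF \<phi>, of n] by (simp add: b[OF \<phi>])
      finally show "\<phi> (cesaro (\<lambda>k. R k e) n) \<le> \<phi> (b n)"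
        by (rule mult_right_le_imp_le) (use \<phi>q[OF \<phi>, of n] in \<open>simp add: b[OF \<phi>]\<close>)
    qed
  qed
  moreover have "order_conv (\<lambda>n. a n - R n (a n)) 0"
  proof (rule order_conv_zeroI[OF b_down])
    fix n
    have RaE: "R n (a n) \<in> Ee e" by (rule Ee_band_image[OF R(1) aE])
    have "a n - R n (a n) \<le> b n"
    proof (rule character_leI[OF Ee_diff[OF aE RaE] bE])
      fix \<phi> assume \<phi>: "character e \<phi>"
      show "\<phi> (a n - R n (a n)) \<le> \<phi> (b n)"
        using dich[OF \<phi>, of n] character_nonneg[OF \<phi> bE b_nonneg, of n]
        by (auto simp: character_diff[OF \<phi> aE RaE] character_band_projection(2)[OF R(1) \<phi> aE])
    qed
    moreover have "0 \<le> a n - R n (a n)" using band_projection_le[OF R(1) a(1)] by (simp only: diff_ge_0_iff_ge)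
    ultimately show "rabs (a n - R n (a n)) \<le> b n" by (simp only: rs.abs_of_nonneg)
  qed
  ultimately show ?thesis using R(1) by blast
qed

text \<open>Applying the dominating operators to \<open>e\<close> turns density zero into order
  convergence of the means of the \<open>R k e\<close>. The complementary part of a tends to 0 in
  order, and passing to means preserves this.\<close>

lemma density_null_imp_cesaro_null:
  fixes a :: "nat \<Rightarrow> 'a"
  assumes a: "\<And>k. 0 \<le> a k" "\<And>k. a k \<le> C *\<^sub>R e" and C: "0 \<le> C"
    and R: "\<And>n. band_projection (R n)" "density_zero R"
    and null: "order_conv (\<lambda>n. a n - R n (a n)) 0"
  shows "order_conv (cesaro a) 0"
proof -
  obtain D where D: "\<And>n x. 0 \<le> x \<Longrightarrow> D (Suc n) x \<le> D n x"
    "\<And>n x. 0 \<le> x \<Longrightarrow> cesaro (\<lambda>k. R k x) n \<le> D n x" "\<And>x. 0 \<le> x \<Longrightarrow> (INF n. D n x) = 0"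
    using R(2) unfolding density_zero_def by metis
  have Re0: "0 \<le> cesaro (\<lambda>k. R k e) n" for n by (intro cesaro_nonneg band_projection_nonneg[OF R(1)] e_nonneg)
  have "down_zero (\<lambda>n. D n e)"
    unfolding down_zero_iff_INF decseq_Suc_iff
    using D e_nonneg order_trans[OF Re0 D(2)] by blast
  then have "order_conv (\<lambda>n. cesaro (\<lambda>k. R k e) n) 0"
    by (rule order_conv_zeroI) (simp only: rs.abs_of_nonneg[OF Re0] D(2)[OF e_nonneg])
  then have "order_conv (\<lambda>n. C *\<^sub>R cesaro (\<lambda>k. R k e) n) 0" by (rule order_conv_zero_scaleR)
  then have 1: "order_conv (cesaro (\<lambda>k. R k (a k))) 0"
  proof (rule order_conv_zero_mono)
    fix n
    have "R k (a k) \<le> C *\<^sub>R R k e" for k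
      using band_projection_mono[OF R(1) a(2), of k k]
      by (simp only: linear_cmul[OF band_projection_linear[OF R(1)]])
    then have "cesaro (\<lambda>k. R k (a k)) n \<le> C *\<^sub>R cesaro (\<lambda>k. R k e) n"
      unfolding cesaro_scaleR[symmetric] by (rule cesaro_mono)
    moreover have "0 \<le> cesaro (\<lambda>k. R k (a k)) n"
      by (intro cesaro_nonneg band_projection_nonneg[OF R(1)] a)
    ultimately show "rabs (cesaro (\<lambda>k. R k (a k)) n) \<le> rabs (C *\<^sub>R cesaro (\<lambda>k. R k e) n)"
      by (subst rs.abs_of_nonneg) (blast intro: order_trans[OF _ rs.abs_ge_self])+
  qed
  have 2: "order_conv (cesaro (\<lambda>k. a k - R k (a k))) 0"
    using null band_projection_le[OF R(1) a(1)]
    by (intro order_conv_zero_cesaro) (simp_all only: diff_ge_0_iff_ge)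
  have "cesaro a n = cesaro (\<lambda>k. R k (a k)) n + cesaro (\<lambda>k. a k - R k (a k)) n" for n
    unfolding cesaro_add[symmetric] by simp
  then show ?thesis using order_conv_zero_add[OF 1 2] by simp
qed

end

section \<open>The equivalences\<close>

lemma CEPS_imp_ceps:
  assumes *: "CEPS T S e"
  shows "ceps e T S"
proof (intro ceps.intro unit_ideal.intro ceps_axioms.intro)
  show "0 \<le> e" "linear T" "T e = e" "linear S" "S e = e"
    using * by (auto simp: CEPS_def weak_order_unit_def cond_exp_op_def riesz_hom_def)
  show "0 \<le> T x" if "0 \<le> x" for x
    using * that by (auto simp: CEPS_def cond_exp_op_def positive_op_def)
  show "0 \<le> S x" if "0 \<le> x" for x
  proof -
    have "S (sup x 0) = sup (S x) (S 0)" "linear S" using * by (simp_all add: CEPS_def riesz_hom_def)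
    then have "S x = sup (S x) 0" using that by (simp add: sup_absorb1 linear_0)
    then show ?thesis by (metis sup_ge2)
  qed
qed

theorem theorem4p4:
  fixes T S :: "'a::{ordered_real_vector, conditionally_complete_lattice} \<Rightarrow> 'a" and e :: 'a
  assumes "CEPS T S e"
  defines "m \<equiv> emult e"
  shows "((\<forall>P Q. band_projection P \<and> band_projection Q \<longrightarrow>
            order_conv (\<lambda>n. (1 / real n) *\<^sub>R
              (\<Sum>k<n. rabs (T (m ((S ^^ k) (P e)) (Q e)) - m (T (P e)) (T (Q e))))) 0)
      \<longleftrightarrow>
         (\<forall>f g. f \<in> Ee e \<and> g \<in> Ee e \<longrightarrow>
            order_conv (\<lambda>n. (1 / real n) *\<^sub>R
              (\<Sum>k<n. rabs (T (m ((S ^^ k) f) g) - m (T f) (T g)))) 0))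
    \<and> ((\<forall>P Q. band_projection P \<and> band_projection Q \<longrightarrow>
            order_conv (\<lambda>n. (1 / real n) *\<^sub>R
              (\<Sum>k<n. rabs (T (m ((S ^^ k) (P e)) (Q e)) - m (T (P e)) (T (Q e))))) 0)
      \<longleftrightarrow>
         (\<forall>P Q. band_projection P \<and> band_projection Q \<longrightarrow>
            (\<exists>R. (\<forall>n. band_projection (R n)) \<and> density_zero R \<and>
               order_conv (\<lambda>n. rabs (T (m ((S ^^ n) (P e)) (Q e)) - m (T (P e)) (T (Q e)))
                  - R n (rabs (T (m ((S ^^ n) (P e)) (Q e)) - m (T (P e)) (T (Q e))))) 0)))"
proof -
  interpret ceps e T S by (rule CEPS_imp_ceps) fact
  have wu: "weak_order_unit e" using assms(1) by (simp add: CEPS_def)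
  have "(\<forall>P Q. band_projection P \<and> band_projection Q \<longrightarrow>
      order_conv (cesaro (\<lambda>k. rabs (covar k (P e) (Q e)))) 0) \<longleftrightarrow>
    (\<forall>f g. f \<in> Ee e \<and> g \<in> Ee e \<longrightarrow> order_conv (cesaro (\<lambda>k. rabs (covar k f g))) 0)"
    (is "?wm \<longleftrightarrow> ?ext")
  proof
    assume wm: ?wm
    show ?ext
    proof (intro allI impI, elim conjE)
      fix f g assume "f \<in> Ee e" "g \<in> Ee e"
      then show "order_conv (cesaro (\<lambda>k. rabs (covar k f g))) 0"
      proof (rule weak_mixing_extends[rotated])
        show "order_conv (cesaro (\<lambda>k. rabs (covar k (P e) (Q e)))) 0"
          if "band_projection P" "band_projection Q" for P Q
          using that by (intro wm[rule_format] conjI)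
      qed
    qed
  next
    assume ext: ?ext
    show ?wm
      by (intro allI impI ext[rule_format] conjI Ee_band_unit) (erule conjunct1 conjunct2)+
  qed
  moreover have "order_conv (cesaro (\<lambda>k. rabs (covar k (P e) (Q e)))) 0 \<longleftrightarrow>
      (\<exists>R. (\<forall>n. band_projection (R n)) \<and> density_zero R \<and>
        order_conv (\<lambda>n. rabs (covar n (P e) (Q e)) - R n (rabs (covar n (P e) (Q e)))) 0)"
    if PQ: "band_projection P" "band_projection Q" for P Q
  proof -
    \<comment> \<open>These bounds give a constant 2 a b above all covariances, independent of k, as
      both directions of the density argument require.\<close>
    obtain a b where ab: "0 < a" "rabs (P e) \<le> a *\<^sub>R e" "0 < b" "rabs (Q e) \<le> b *\<^sub>R e"
      using Ee_bound[OF Ee_band_unit[OF PQ(1)]] Ee_bound[OF Ee_band_unit[OF PQ(2)]] by metis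
    define x where "x k = rabs (covar k (P e) (Q e))" for k
    have x: "0 \<le> x k" "x k \<le> (2 * a * b) *\<^sub>R e" for k
      unfolding x_def using covar_bound[OF ab(2,4)] by simp_all
    have C: "0 \<le> 2 * a * b" using ab by simp
    have "order_conv (cesaro x) 0 \<longleftrightarrow> (\<exists>R. (\<forall>n. band_projection (R n)) \<and> density_zero R \<and>
        order_conv (\<lambda>n. x n - R n (x n)) 0)"
      using cesaro_null_imp_density_null[of x, OF wu x C] density_null_imp_cesaro_null[of x, OF x C]
      by blast
    then show ?thesis unfolding x_def .
  qed
  then have "(\<forall>P Q. band_projection P \<and> band_projection Q \<longrightarrow>
      order_conv (cesaro (\<lambda>k. rabs (covar k (P e) (Q e)))) 0) \<longleftrightarrow>
    (\<forall>P Q. band_projection P \<and> band_projection Q \<longrightarrow>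
      (\<exists>R. (\<forall>n. band_projection (R n)) \<and> density_zero R \<and>
        order_conv (\<lambda>n. rabs (covar n (P e) (Q e)) - R n (rabs (covar n (P e) (Q e)))) 0))"
    by simp
  ultimately show ?thesis unfolding covar_def m_def by (rule conjI)
qed

end
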